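(* Let $H,G$ be finite bounded prelinear Hilbert algebras. Let $H\coprod_f G$ be the bounded prelinear Hilbert algebra dual to the product in $\mathsf{hFor}$ of the objects dual to $H$ and $G$, that is, $$H\coprod_f G=\mathbf{D}\bigl(X(H)\otimes X(G),\ \preceq,\ \kappa_H\otimes\kappa_G\bigr),$$ where $X(H)$ and $X(G)$ are regarded as forests ordered by reverse inclusion. Then $H\coprod_f G$ is isomorphic to the coproduct $H\coprod_{\mathsf{PHil_0}}G$ of $H$ and $G$ in the category $\mathsf{PHil_0}$ of bounded prelinear Hilbert algebras.
   Context: A Hilbert algebra is an algebra $(H,\to,1)$ of type $(2,0)$ such that for all $a,b,c\in H$: $a\to(b\to a)=1$; $(a\to(b\to c))\to((a\to b)\to(a\to c))=1$; and $a\to b=b\to a=1$ implies $a=b$. Its natural order is $a\le b$ iff $a\to b=1$. A Hilbert chain is a Hilbert algebra whose natural order is total; a prelinear Hilbert algebra is a member of the variety generated by the Hilbert chains. A bounded prelinear Hilbert algebra is $(H,\to,1,0)$ with $(H,\to,1)$ a prelinear Hilbert algebra and $0\le a$ for all $a$; morphisms of $\mathsf{PHil_0}$ preserve $\to,1,0$. An implicative filter of $H$ is a subset $F$ with $1\in F$ such that $a,a\to b\in F$ imply $b\in F$; it is irreducible if $F\ne H$ and $F=F_1\cap F_2$ with $F_i$ implicative filters implies $F=F_1$ or $F=F_2$. $X(H)$ is the set of irreducible implicative filters. For $a\in H$ let $\varphi_H(a)=\{P\in X(H):a\in P\}$, and let $\kappa_H=\{X(H)\setminus\varphi_H(a):a\in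 H\}$. A finite forest is a finite poset in which $(x]=\{y:y\le x\}$ is a chain for every $x$. For a subset $U$ of a poset, $U^m$ is the set of minimal elements of $U$, $[U)$ is the generated upset, $[x)=[\{x\})$. The objects of $\mathsf{hFor}$ are triples $(X,\le,\mathcal{B}_X)$ with $(X,\le)$ a finite forest and $\mathcal{B}_X$ a family of upsets of $X$ with $X\in\mathcal{B}_X$, $[x)\in\mathcal{B}_X$ for all $x\in X$, and $[M)\in\mathcal{B}_X$ whenever $B\in\mathcal{B}_X$ and $M\subseteq B^m$. Morphisms are order-preserving maps $f$ that are open (if $y\le f(x)$ there is $z\le x$ with $f(z)=y$) with $f^{-1}(U)\in\mathcal{B}_X$ for all $U\in\mathcal{B}_Y$. The object of $\mathsf{hFor}$ dual to a finite bounded prelinear Hilbert algebra $H$ is $(X(H),\supseteq,\kappa_H)$; the bounded prelinear Hilbert algebra $\mathbf{D}(X,\le,\mathcal{B})$ dual to an object of $\mathsf{hFor}$ is the set $\{U\subseteq X:X\setminus U\in\mathcal{B}\}$ with $U\Rightarrow V=X\setminus[U\setminus V)$, $1=X$, $0=\emptyset$. For a finite poset $F$, $\mathrm{US}(F)$ is the set of sets $\{f_0,\dots,f_n\}$ with $f_0$ minimal in $F$ and $f_0<\dots<f_n$, ordered by $\{f_0<\dots<f_n\}\preceq\{g_0<\dots<g_m\}$ iff $n\le m$ and $f_i=g_i$ for $i=0,\dots,n$. For forests $X,Y$, with $\pi_1,\pi_2$ the coordinate projections of the product poset $X\times Y$ and $\hat\pi_j(p)=\{\pi_j(p_0),\dots,\pi_j(p_k)\}$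 for $p=\{p_0<\dots<p_k\}$, $X\otimes Y$ is the set of $p=\{p_0<\dots<p_k\}\in\mathrm{US}(X\times Y)$ with $\hat\pi_1(p)=(\pi_1(p_k)]$ and $\hat\pi_2(p)=(\pi_2(p_k)]$, ordered by $\preceq$; $\overline{\pi_j}(p)=\max\hat\pi_j(p)$. $\mathcal{B}_X\otimes\mathcal{B}_Y$ is the family of all $U\subseteq X\otimes Y$ such that $U=[u)$ for some $u\in X\otimes Y$, or $U=[T)$ for some $T\subseteq((\overline{\pi_1})^{-1}(V))^m$ with $V\in\mathcal{B}_X$, or $U=[T)$ for some $T\subseteq((\overline{\pi_2})^{-1}(V))^m$ with $V\in\mathcal{B}_Y$. *)

theory Defs
  imports "HOL-Library.FuncSet" "HOL-Library.Countable_Set" "HOL-Algebra.Congruence"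
begin

section \<open>Hilbert algebras\<close>

record 'a hilbert = "'a partial_object" +
  imp :: "'a \<Rightarrow> 'a \<Rightarrow> 'a"
  tt :: 'a

definition hilbert_algebra :: "('a, 'm) hilbert_scheme \<Rightarrow> bool" where
  "hilbert_algebra H \<longleftrightarrow>
     tt H \<in> carrier H \<and>
     (\<forall>a\<in>carrier H. \<forall>b\<in>carrier H. imp H a b \<in> carrier H) \<and>
     (\<forall>a\<in>carrier H. \<forall>b\<in>carrier H. imp H a (imp H b a) = tt H) \<and>
     (\<forall>a\<in>carrier H. \<forall>b\<in>carrier H. \<forall>c\<in>carrier H.
        imp H (imp H a (imp H b c)) (imp H (imp H a b) (imp H a c)) = tt H) \<and>
     (\<forall>a\<in>carrier H. \<forall>b\<in>carrier H. imp H a b = tt H \<and> imp H b a = tt H \<longrightarrow> a = b)"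

definition hil_le :: "('a, 'm) hilbert_scheme \<Rightarrow> 'a \<Rightarrow> 'a \<Rightarrow> bool" where
  "hil_le H a b \<longleftrightarrow> imp H a b = tt H"

definition hilbert_chain :: "('a, 'm) hilbert_scheme \<Rightarrow> bool" where
  "hilbert_chain H \<longleftrightarrow> hilbert_algebra H \<and>
     (\<forall>a\<in>carrier H. \<forall>b\<in>carrier H. hil_le H a b \<or> hil_le H b a)"

subsection \<open>The variety generated by the Hilbert chains\<close>

datatype hterm = Var nat | One | Imp hterm hterm

instance hterm :: countable by countable_datatype

primrec eval :: "('a, 'm) hilbert_scheme \<Rightarrow> (nat \<Rightarrow> 'a) \<Rightarrow> hterm \<Rightarrow> 'a" where
  "eval H v (Var i) = v i"
| "eval H v One = tt H"
| "eval H v (Imp s t) = imp H (eval H v s) (eval H v t)"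

definition satisfies :: "('a, 'm) hilbert_scheme \<Rightarrow> hterm \<Rightarrow> hterm \<Rightarrow> bool" where
  "satisfies H s t \<longleftrightarrow> (\<forall>v. (\<forall>i. v i \<in> carrier H) \<longrightarrow> eval H v s = eval H v t)"

text \<open>The identities holding in all Hilbert chains.  A definition cannot quantify over all types;
  chains on sets of natural numbers suffice by lemma \<open>chain_identity_all_types\<close> below.\<close>

definition chain_identity :: "hterm \<Rightarrow> hterm \<Rightarrow> bool" where
  "chain_identity s t \<longleftrightarrow> (\<forall>C :: nat hilbert. hilbert_chain C \<longrightarrow> satisfies C s t)"

definition prelinear_hilbert :: "('a, 'm) hilbert_scheme \<Rightarrow> bool" where
  "prelinear_hilbert H \<longleftrightarrow> hilbert_algebra H \<and> (\<forall>s t. chain_identity s t \<longrightarrow> satisfies H s t)"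

subsection \<open>The category of bounded prelinear Hilbert algebras\<close>

record 'a bhilbert = "'a hilbert" +
  ff :: 'a

definition bounded_prelinear_hilbert :: "'a bhilbert \<Rightarrow> bool" where
  "bounded_prelinear_hilbert H \<longleftrightarrow> prelinear_hilbert H \<and> ff H \<in> carrier H \<and>
     (\<forall>a\<in>carrier H. hil_le H (ff H) a)"

definition bhil_hom :: "'a bhilbert \<Rightarrow> 'b bhilbert \<Rightarrow> ('a \<Rightarrow> 'b) set" where
  "bhil_hom H K = {h \<in> carrier H \<rightarrow>\<^sub>E carrier K.
     (\<forall>a\<in>carrier H. \<forall>b\<in>carrier H. h (imp H a b) = imp K (h a) (h b)) \<and>
     h (tt H) = tt K \<and> h (ff H) = ff K}"

text \<open>A coproduct is determined up to isomorphism, so that an algebra \<open>C\<close> is isomorphic to the coproduct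
  of \<open>H\<close> and \<open>G\<close> iff it is one for some pair of injections.
  The type argument is the type carrying the algebras \<open>K\<close> against which the universal property
  is tested; by lemma \<open>bhil_coproduct_nat\<close> below, \<open>nat\<close> is as good as any other type when the
  algebras involved are countable.\<close>

definition bhil_coproduct ::
  "'c itself \<Rightarrow> 'a bhilbert \<Rightarrow> 'b bhilbert \<Rightarrow> 'd bhilbert \<Rightarrow> ('a \<Rightarrow> 'd) \<Rightarrow> ('b \<Rightarrow> 'd) \<Rightarrow> bool" where
  "bhil_coproduct _ H G C \<iota>\<^sub>1 \<iota>\<^sub>2 \<longleftrightarrow>
     bounded_prelinear_hilbert C \<and> \<iota>\<^sub>1 \<in> bhil_hom H C \<and> \<iota>\<^sub>2 \<in> bhil_hom G C \<and>
     (\<forall>K :: 'c bhilbert. bounded_prelinear_hilbert K \<longrightarrow>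
        (\<forall>f\<in>bhil_hom H K. \<forall>g\<in>bhil_hom G K.
           \<exists>!h. h \<in> bhil_hom C K \<and>
                (\<forall>a\<in>carrier H. h (\<iota>\<^sub>1 a) = f a) \<and> (\<forall>b\<in>carrier G. h (\<iota>\<^sub>2 b) = g b)))"

section \<open>Irreducible implicative filters\<close>

definition implicative_filter :: "('a, 'm) hilbert_scheme \<Rightarrow> 'a set \<Rightarrow> bool" where
  "implicative_filter H F \<longleftrightarrow> F \<subseteq> carrier H \<and> tt H \<in> F \<and>
     (\<forall>a\<in>carrier H. \<forall>b\<in>carrier H. a \<in> F \<and> imp H a b \<in> F \<longrightarrow> b \<in> F)"

definition irreducible_filter :: "('a, 'm) hilbert_scheme \<Rightarrow> 'a set \<Rightarrow> bool" where
  "irreducible_filter H P \<longleftrightarrow> implicative_filter H P \<and> P \<noteq> carrier H \<and>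
     (\<forall>F\<^sub>1 F\<^sub>2. implicative_filter H F\<^sub>1 \<and> implicative_filter H F\<^sub>2 \<and> P = F\<^sub>1 \<inter> F\<^sub>2 \<longrightarrow> P = F\<^sub>1 \<or> P = F\<^sub>2)"

definition irr_filters :: "('a, 'm) hilbert_scheme \<Rightarrow> 'a set set" where
  "irr_filters H = {P. irreducible_filter H P}"

definition phi :: "('a, 'm) hilbert_scheme \<Rightarrow> 'a \<Rightarrow> 'a set set" where
  "phi H a = {P \<in> irr_filters H. a \<in> P}"

definition kappa :: "('a, 'm) hilbert_scheme \<Rightarrow> 'a set set set" where
  "kappa H = {irr_filters H - phi H a | a. a \<in> carrier H}"

section \<open>Posets with a family of upsets\<close>

text \<open>The records are raw data: that \<open>leq\<close> is a forest order on \<open>carrier\<close> and that \<open>fam\<close> is a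
  family of upsets with the closure properties of an object of \<open>hFor\<close> is not built in.\<close>

record 'a pos = "'a partial_object" +
  leq :: "'a \<Rightarrow> 'a \<Rightarrow> bool"

record 'a hfor = "'a pos" +
  fam :: "'a set set"

definition downset :: "('a, 'm) pos_scheme \<Rightarrow> 'a \<Rightarrow> 'a set" where
  "downset X x = {y \<in> carrier X. leq X y x}"

definition upset :: "('a, 'm) pos_scheme \<Rightarrow> 'a set \<Rightarrow> 'a set" where
  "upset X U = {y \<in> carrier X. \<exists>x\<in>U. leq X x y}"

definition minimals :: "('a, 'm) pos_scheme \<Rightarrow> 'a set \<Rightarrow> 'a set" where
  "minimals X U = {x \<in> U. \<forall>y\<in>U. leq X y x \<longrightarrow> y = x}"

definition greatest_of :: "('a, 'm) pos_scheme \<Rightarrow> 'a set \<Rightarrow> 'a" where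
  "greatest_of X U = (THE x. x \<in> U \<and> (\<forall>y\<in>U. leq X y x))"

subsection \<open>The two halves of the duality on objects\<close>

definition dual_space :: "('a, 'm) hilbert_scheme \<Rightarrow> 'a set hfor" where
  "dual_space H = \<lparr>carrier = irr_filters H, leq = (\<lambda>P Q. P \<supseteq> Q), fam = kappa H\<rparr>"

definition dual_algebra :: "'a hfor \<Rightarrow> 'a set bhilbert" where
  "dual_algebra X =
     \<lparr>carrier = {U. U \<subseteq> carrier X \<and> carrier X - U \<in> fam X},
      imp = (\<lambda>U V. carrier X - upset X (U - V)),
      tt = carrier X,
      ff = {}\<rparr>"

subsection \<open>The product of forests\<close>

definition prod_pos :: "('a, 'm) pos_scheme \<Rightarrow> ('b, 'n) pos_scheme \<Rightarrow> ('a \<times> 'b) pos" where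
  "prod_pos X Y =
     \<lparr>carrier = carrier X \<times> carrier Y,
      leq = (\<lambda>p q. leq X (fst p) (fst q) \<and> leq Y (snd p) (snd q))\<rparr>"

text \<open>The list \<open>fs = [f\<^sub>0, \<dots>, f\<^sub>n]\<close> enumerates the set \<open>p\<close>, with \<open>f\<^sub>0 < \<dots> < f\<^sub>n\<close>.\<close>

definition enumerates :: "('a, 'm) pos_scheme \<Rightarrow> 'a list \<Rightarrow> 'a set \<Rightarrow> bool" where
  "enumerates F fs p \<longleftrightarrow> fs \<noteq> [] \<and> set fs = p \<and> p \<subseteq> carrier F \<and>
     sorted_wrt (\<lambda>x y. leq F x y \<and> x \<noteq> y) fs"

definition US :: "('a, 'm) pos_scheme \<Rightarrow> 'a set set" where
  "US F = {p. \<exists>fs. enumerates F fs p \<and> hd fs \<in> minimals F (carrier F)}"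

definition US_le :: "('a, 'm) pos_scheme \<Rightarrow> 'a set \<Rightarrow> 'a set \<Rightarrow> bool" where
  "US_le F p q \<longleftrightarrow> (\<exists>fs gs. enumerates F fs p \<and> enumerates F gs q \<and>
     length fs \<le> length gs \<and> (\<forall>i<length fs. fs ! i = gs ! i))"

definition tensor_carrier ::
  "('a, 'm) pos_scheme \<Rightarrow> ('b, 'n) pos_scheme \<Rightarrow> ('a \<times> 'b) set set" where
  "tensor_carrier X Y = {p \<in> US (prod_pos X Y). \<exists>ps. enumerates (prod_pos X Y) ps p \<and>
     fst ` p = downset X (fst (last ps)) \<and> snd ` p = downset Y (snd (last ps))}"

definition tensor_pos ::
  "('a, 'm) pos_scheme \<Rightarrow> ('b, 'n) pos_scheme \<Rightarrow> ('a \<times> 'b) set pos" where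
  "tensor_pos X Y = \<lparr>carrier = tensor_carrier X Y, leq = US_le (prod_pos X Y)\<rparr>"

definition tproj1 :: "('a, 'm) pos_scheme \<Rightarrow> ('a \<times> 'b) set \<Rightarrow> 'a" where
  "tproj1 X p = greatest_of X (fst ` p)"

definition tproj2 :: "('b, 'n) pos_scheme \<Rightarrow> ('a \<times> 'b) set \<Rightarrow> 'b" where
  "tproj2 Y p = greatest_of Y (snd ` p)"

definition tensor_fam :: "'a hfor \<Rightarrow> 'b hfor \<Rightarrow> ('a \<times> 'b) set set set" where
  "tensor_fam X Y =
     {upset (tensor_pos X Y) {u} | u. u \<in> tensor_carrier X Y} \<union>
     {upset (tensor_pos X Y) T | T V. V \<in> fam X \<and>
        T \<subseteq> minimals (tensor_pos X Y) {p \<in> tensor_carrier X Y. tproj1 X p \<in> V}} \<union>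
     {upset (tensor_pos X Y) T | T V. V \<in> fam Y \<and>
        T \<subseteq> minimals (tensor_pos X Y) {p \<in> tensor_carrier X Y. tproj2 Y p \<in> V}}"

definition tensor :: "'a hfor \<Rightarrow> 'b hfor \<Rightarrow> ('a \<times> 'b) set hfor" where
  "tensor X Y =
     \<lparr>carrier = tensor_carrier X Y, leq = US_le (prod_pos X Y), fam = tensor_fam X Y\<rparr>"

definition fin_coproduct :: "'a bhilbert \<Rightarrow> 'b bhilbert \<Rightarrow> ('a set \<times> 'b set) set set bhilbert" where
  "fin_coproduct H G = dual_algebra (tensor (dual_space H) (dual_space G))"

section \<open>Independence of the choice of carrier types\<close>

definition subuniverse :: "('a, 'm) hilbert_scheme \<Rightarrow> 'a set \<Rightarrow> bool" where
  "subuniverse K S \<longleftrightarrow> S \<subseteq> carrier K \<and> tt K \<in> S \<and> (\<forall>a\<in>S. \<forall>b\<in>S. imp K a b \<in> S)"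

definition transport :: "('a \<Rightarrow> 'b) \<Rightarrow> ('a, 'm) hilbert_scheme \<Rightarrow> 'a set \<Rightarrow> 'b hilbert" where
  "transport e K S = \<lparr>carrier = e ` S,
     imp = (\<lambda>x y. e (imp K (inv_into S e x) (inv_into S e y))), tt = e (tt K)\<rparr>"

lemma eval_in_subuniverse:
  assumes "subuniverse K S" "\<And>i. v i \<in> S"
  shows "eval K v t \<in> S"
  using assms by (induction t) (auto simp: subuniverse_def)

lemma countable_subuniverse:
  assumes K: "hilbert_algebra K" and A: "countable A" "A \<subseteq> carrier K"
  obtains S where "subuniverse K S" "countable S" "A \<subseteq> S"
proof -
  define v where "v = from_nat_into (insert (tt K) A)"
  define S where "S = range (eval K v)"
  have sub: "subuniverse K (carrier K)"
    using K unfolding subuniverse_def hilbert_algebra_def by blast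
  then have ins: "insert (tt K) A \<subseteq> carrier K"
    using A(2) unfolding subuniverse_def by blast
  have v: "v i \<in> carrier K" for i
    unfolding v_def by (rule subsetD[OF ins from_nat_into[OF insert_not_empty]])
  have "S \<subseteq> carrier K"
    unfolding S_def by (rule image_subsetI) (rule eval_in_subuniverse[OF sub v])
  moreover have "tt K \<in> S"
    unfolding S_def by (rule range_eqI[of _ _ One]) simp
  moreover have "imp K a b \<in> S" if ab: "a \<in> S" "b \<in> S" for a b
  proof -
    obtain s t where "a = eval K v s" "b = eval K v t"
      using ab unfolding S_def by blast
    then show ?thesis
      unfolding S_def by (intro range_eqI[of _ _ "Imp s t"]) simp
  qed
  ultimately have "subuniverse K S"
    unfolding subuniverse_def by blast
  moreover have "countable S"
    unfolding S_def by (rule countable_image[OF countableI_type])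
  moreover have "A \<subseteq> S"
  proof
    fix a
    assume "a \<in> A"
    then obtain n where "v n = a"
      using from_nat_into_surj[OF countable_insert[OF A(1)], of a "tt K"] unfolding v_def by blast
    then show "a \<in> S"
      unfolding S_def by (intro range_eqI[of _ _ "Var n"]) simp
  qed
  ultimately show ?thesis
    by (rule that)
qed

lemma hilbert_algebra_transport:
  assumes K: "hilbert_algebra K" and S: "subuniverse K S" and e: "inj_on e S"
  shows "hilbert_algebra (transport e K S)"
proof -
  have cl: "a \<in> S \<Longrightarrow> a \<in> carrier K" "tt K \<in> S" "a \<in> S \<Longrightarrow> b \<in> S \<Longrightarrow> imp K a b \<in> S" for a b
    using S by (auto simp: subuniverse_def)
  have imp: "imp (transport e K S) (e a) (e b) = e (imp K a b)" if "a \<in> S" "b \<in> S" for a b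
    using that e by (simp add: transport_def)
  have tt: "tt (transport e K S) = e (tt K)" and carrier: "carrier (transport e K S) = e ` S"
    by (simp_all add: transport_def)
  have ax1: "imp K a (imp K b a) = tt K" if "a \<in> S" "b \<in> S" for a b
    using K that[THEN cl(1)] unfolding hilbert_algebra_def by blast
  have ax2: "imp K (imp K a (imp K b c)) (imp K (imp K a b) (imp K a c)) = tt K"
    if "a \<in> S" "b \<in> S" "c \<in> S" for a b c
    using K that[THEN cl(1)] unfolding hilbert_algebra_def by blast
  have ax3: "a = b" if "a \<in> S" "b \<in> S" "imp K a b = tt K \<and> imp K b a = tt K" for a b
    using K that(1,2)[THEN cl(1)] that(3) unfolding hilbert_algebra_def by blast
  have eq: "e a = e b \<longleftrightarrow> a = b" if "a \<in> S" "b \<in> S" for a b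
    using e that by (rule inj_on_eq_iff)
  show ?thesis
    unfolding hilbert_algebra_def carrier tt ball_simps
  proof (intro conjI ballI impI)
    fix a b
    assume ab: "a \<in> S" "b \<in> S"
    show "imp (transport e K S) (e a) (e b) \<in> e ` S"
      using ab by (simp add: imp cl)
    show "imp (transport e K S) (e a) (imp (transport e K S) (e b) (e a)) = e (tt K)"
      using ab by (simp add: imp cl ax1)
    assume "imp (transport e K S) (e a) (e b) = e (tt K) \<and> imp (transport e K S) (e b) (e a) = e (tt K)"
    then have "imp K a b = tt K \<and> imp K b a = tt K"
      using ab by (simp add: imp cl eq)
    then show "e a = e b"
      using ax3 ab by blast
  qed (simp_all add: imp cl ax2)
qed

lemma hil_le_transport:
  assumes "inj_on e S" "a \<in> S" "b \<in> S" "hil_le K a b"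
  shows "hil_le (transport e K S) (e a) (e b)"
  using assms by (simp add: hil_le_def transport_def)

lemma eval_transport:
  assumes "subuniverse K S" "inj_on e S" "\<And>i. v i \<in> S"
  shows "eval (transport e K S) (e \<circ> v) t = e (eval K v t)"
proof (induction t)
  case (Imp s t)
  then show ?case
    using eval_in_subuniverse[OF assms(1), of v] assms(2,3)
    by (auto simp: transport_def)
qed (auto simp: transport_def)

lemma chain_identity_all_types:
  fixes C :: "('a, 'm) hilbert_scheme"
  assumes "chain_identity s t" "hilbert_chain C"
  shows "satisfies C s t"
  unfolding satisfies_def
proof (intro allI impI)
  fix v :: "nat \<Rightarrow> 'a"
  assume v: "\<forall>i. v i \<in> carrier C"
  have C: "hilbert_algebra C"
    using assms(2) by (simp add: hilbert_chain_def)
  have A: "countable (range v)" "range v \<subseteq> carrier C"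
    using v by auto
  obtain S where S: "subuniverse C S" "countable S" "range v \<subseteq> S"
    using countable_subuniverse[OF C A] by blast
  have vS: "v i \<in> S" for i
    using S(3) by auto
  let ?e = "to_nat_on S"
  have e: "inj_on ?e S"
    by (rule inj_on_to_nat_on[OF S(2)])
  have "hilbert_chain (transport ?e C S)"
    unfolding hilbert_chain_def
  proof (intro conjI ballI)
    show "hilbert_algebra (transport ?e C S)"
      by (rule hilbert_algebra_transport[OF C S(1) e])
  next
    fix a b
    assume "a \<in> carrier (transport ?e C S)" "b \<in> carrier (transport ?e C S)"
    then obtain x y where xy: "a = ?e x" "b = ?e y" "x \<in> S" "y \<in> S"
      by (auto simp: transport_def)
    have "x \<in> carrier C" "y \<in> carrier C"
      using S(1) xy(3,4) unfolding subuniverse_def by blast+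
    then have "hil_le C x y \<or> hil_le C y x"
      using assms(2) unfolding hilbert_chain_def by blast
    then show "hil_le (transport ?e C S) a b \<or> hil_le (transport ?e C S) b a"
      unfolding xy(1,2) using hil_le_transport[OF e] xy(3,4) by blast
  qed
  then have "satisfies (transport ?e C S) s t"
    using assms(1) by (simp add: chain_identity_def)
  moreover have "\<forall>i. (?e \<circ> v) i \<in> carrier (transport ?e C S)"
    using vS by (simp add: transport_def)
  ultimately have "eval (transport ?e C S) (?e \<circ> v) s = eval (transport ?e C S) (?e \<circ> v) t"
    unfolding satisfies_def by blast
  then have "?e (eval C v s) = ?e (eval C v t)"
    by (simp only: eval_transport[OF S(1) e vS])
  then show "eval C v s = eval C v t"
    by (rule inj_onD[OF e _ eval_in_subuniverse[OF S(1) vS] eval_in_subuniverse[OF S(1) vS]])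
qed

lemma bounded_prelinear_transport:
  fixes K :: "'a bhilbert" and e :: "'a \<Rightarrow> 'b"
  assumes K: "bounded_prelinear_hilbert K"
    and S: "subuniverse K S" "ff K \<in> S" and e: "inj_on e S"
  defines "N \<equiv> \<lparr>carrier = e ` S,
     imp = (\<lambda>x y. e (imp K (inv_into S e x) (inv_into S e y))), tt = e (tt K), ff = e (ff K)\<rparr>"
  shows "bounded_prelinear_hilbert N"
proof -
  have N: "carrier N = carrier (transport e K S)" "imp N = imp (transport e K S)"
    "tt N = tt (transport e K S)"
    by (simp_all add: N_def transport_def)
  have ev: "eval N w t = eval (transport e K S) w t" for w t
    by (induction t) (simp_all add: N)
  have HK: "hilbert_algebra K"
    using K by (simp add: bounded_prelinear_hilbert_def prelinear_hilbert_def)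
  have "hilbert_algebra N"
    unfolding hilbert_algebra_def N
    by (rule hilbert_algebra_transport[OF HK S(1) e, unfolded hilbert_algebra_def])
  moreover have "satisfies N s t" if "chain_identity s t" for s t
    unfolding satisfies_def
  proof (intro allI impI)
    fix w :: "nat \<Rightarrow> 'b"
    assume w: "\<forall>i. w i \<in> carrier N"
    define v where "v = inv_into S e \<circ> w"
    have v: "v i \<in> S" for i
      using w unfolding v_def N_def by (simp add: inv_into_into)
    have ew: "e \<circ> v = w"
      using w unfolding v_def N_def by (simp add: f_inv_into_f fun_eq_iff)
    have "satisfies K s t"
      using K that by (simp add: bounded_prelinear_hilbert_def prelinear_hilbert_def)
    then have "eval K v s = eval K v t"
      using v S(1) unfolding satisfies_def subuniverse_def by blast
    then show "eval N w s = eval N w t"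
      unfolding ev ew[symmetric] by (simp add: eval_transport[OF S(1) e v])
  qed
  moreover have "hil_le N (ff N) a" if a: "a \<in> carrier N" for a
  proof -
    obtain x where x: "x \<in> S" "a = e x"
      using a by (auto simp: N_def)
    then have "x \<in> carrier K"
      using S(1) unfolding subuniverse_def by blast
    then have "hil_le K (ff K) x"
      using K unfolding bounded_prelinear_hilbert_def by blast
    then have "hil_le (transport e K S) (e (ff K)) (e x)"
      by (rule hil_le_transport[OF e S(2) x(1)])
    then show ?thesis
      unfolding hil_le_def N x(2) by (simp add: N_def)
  qed
  moreover have "ff N \<in> carrier N"
    using S(2) by (simp add: N_def)
  ultimately show ?thesis
    unfolding bounded_prelinear_hilbert_def prelinear_hilbert_def by blast
qed

lemma countable_nat_copy:
  fixes K :: "'a bhilbert"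
  assumes K: "bounded_prelinear_hilbert K" and A: "countable A" "A \<subseteq> carrier K"
  obtains N :: "nat bhilbert" and e d where
    "bounded_prelinear_hilbert N" "\<And>x. x \<in> A \<Longrightarrow> e x \<in> carrier N" "\<And>x. x \<in> A \<Longrightarrow> d (e x) = x"
    "\<And>x. x \<in> carrier N \<Longrightarrow> d x \<in> carrier K"
    "\<And>a b. a \<in> A \<Longrightarrow> b \<in> A \<Longrightarrow> e (imp K a b) = imp N (e a) (e b)" "e (tt K) = tt N" "e (ff K) = ff N"
    "\<And>a b. a \<in> carrier N \<Longrightarrow> b \<in> carrier N \<Longrightarrow> d (imp N a b) = imp K (d a) (d b)"
    "d (tt N) = tt K" "d (ff N) = ff K"
proof -
  have HK: "hilbert_algebra K" and fK: "ff K \<in> carrier K"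
    using K by (auto simp: bounded_prelinear_hilbert_def prelinear_hilbert_def)
  have A': "countable (insert (ff K) A)" "insert (ff K) A \<subseteq> carrier K"
    using A fK by auto
  obtain S where S: "subuniverse K S" "countable S" "insert (ff K) A \<subseteq> S"
    using countable_subuniverse[OF HK A'] by blast
  have e: "inj_on (to_nat_on S) S"
    by (rule inj_on_to_nat_on[OF S(2)])
  have fS: "ff K \<in> S"
    using S(3) by auto
  have [simp]: "tt K \<in> S" "ff K \<in> S" "\<And>a b. a \<in> S \<Longrightarrow> b \<in> S \<Longrightarrow> imp K a b \<in> S"
    "\<And>a. a \<in> S \<Longrightarrow> a \<in> carrier K" "\<And>a. a \<in> A \<Longrightarrow> a \<in> S"
    using S by (auto simp: subuniverse_def)
  have [simp]: "inv_into S (to_nat_on S) (to_nat_on S x) = x" if "x \<in> S" for x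
    using e that by (rule inv_into_f_f)
  have "bounded_prelinear_hilbert \<lparr>carrier = to_nat_on S ` S,
      imp = (\<lambda>x y. to_nat_on S (imp K (inv_into S (to_nat_on S) x) (inv_into S (to_nat_on S) y))),
      tt = to_nat_on S (tt K), ff = to_nat_on S (ff K)\<rparr>" (is "bounded_prelinear_hilbert ?N")
    by (rule bounded_prelinear_transport[OF K S(1) fS e])
  then show ?thesis
    by (rule that[of ?N "to_nat_on S" "inv_into S (to_nat_on S)"])
      (assumption | force)+
qed

lemma bhil_hom_compose:
  assumes "f \<in> bhil_hom H K" and "f ` carrier H \<subseteq> A" and "bounded_prelinear_hilbert H"
    and "\<And>x. x \<in> A \<Longrightarrow> e x \<in> carrier N"
    and "\<And>a b. a \<in> A \<Longrightarrow> b \<in> A \<Longrightarrow> e (imp K a b) = imp N (e a) (e b)"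
    and "e (tt K) = tt N" and "e (ff K) = ff N"
  shows "restrict (e \<circ> f) (carrier H) \<in> bhil_hom H N"
proof -
  have fA: "f a \<in> A" if "a \<in> carrier H" for a
    using assms(2) that by auto
  have "hilbert_algebra H" and ff: "ff H \<in> carrier H"
    using assms(3) by (simp_all add: bounded_prelinear_hilbert_def prelinear_hilbert_def)
  then have cl: "tt H \<in> carrier H" "\<And>a b. a \<in> carrier H \<Longrightarrow> b \<in> carrier H \<Longrightarrow> imp H a b \<in> carrier H"
    by (simp_all add: hilbert_algebra_def)
  have f: "f (imp H a b) = imp K (f a) (f b)" if "a \<in> carrier H" "b \<in> carrier H" for a b
    using assms(1) that by (simp add: bhil_hom_def)
  have "f (tt H) = tt K" "f (ff H) = ff K"
    using assms(1) by (simp_all add: bhil_hom_def)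
  then show ?thesis
    unfolding bhil_hom_def by (simp add: fA assms(4-7) ff cl f)
qed

lemma ex1_unique: "\<exists>!x. P x \<Longrightarrow> P a \<Longrightarrow> P b \<Longrightarrow> a = b"
  by blast

lemma bhil_coproduct_nat:
  fixes H :: "'a bhilbert" and G :: "'b bhilbert" and C :: "'d bhilbert"
  assumes H: "bounded_prelinear_hilbert H" "countable (carrier H)"
    and G: "bounded_prelinear_hilbert G" "countable (carrier G)"
    and C: "countable (carrier C)"
    and cop: "bhil_coproduct TYPE(nat) H G C \<iota>\<^sub>1 \<iota>\<^sub>2"
  shows "bhil_coproduct TYPE('c) H G C \<iota>\<^sub>1 \<iota>\<^sub>2"
proof -
  have C': "bounded_prelinear_hilbert C" and i1: "\<iota>\<^sub>1 \<in> bhil_hom H C" and i2: "\<iota>\<^sub>2 \<in> bhil_hom G C"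
    and univ: "\<And>N :: nat bhilbert. \<And>f g. bounded_prelinear_hilbert N \<Longrightarrow> f \<in> bhil_hom H N \<Longrightarrow>
      g \<in> bhil_hom G N \<Longrightarrow> \<exists>!h. h \<in> bhil_hom C N \<and>
        (\<forall>a\<in>carrier H. h (\<iota>\<^sub>1 a) = f a) \<and> (\<forall>b\<in>carrier G. h (\<iota>\<^sub>2 b) = g b)"
    using cop unfolding bhil_coproduct_def by blast+
  have i1c: "\<iota>\<^sub>1 a \<in> carrier C" if "a \<in> carrier H" for a
    using i1 that by (auto simp: bhil_hom_def)
  have i2c: "\<iota>\<^sub>2 a \<in> carrier C" if "a \<in> carrier G" for a
    using i2 that by (auto simp: bhil_hom_def)
  have "\<exists>!h. h \<in> bhil_hom C K \<and>
      (\<forall>a\<in>carrier H. h (\<iota>\<^sub>1 a) = f a) \<and> (\<forall>b\<in>carrier G. h (\<iota>\<^sub>2 b) = g b)"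
    if K: "bounded_prelinear_hilbert K" and f: "f \<in> bhil_hom H K" and g: "g \<in> bhil_hom G K"
    for K :: "'c bhilbert" and f g
  proof (rule ex_ex1I)
    let ?A = "f ` carrier H \<union> g ` carrier G"
    have A: "countable ?A" "?A \<subseteq> carrier K"
      using H G f g by (auto simp: bhil_hom_def)
    obtain N :: "nat bhilbert" and e d where N: "bounded_prelinear_hilbert N"
      and e: "\<And>x. x \<in> ?A \<Longrightarrow> e x \<in> carrier N" and de: "\<And>x. x \<in> ?A \<Longrightarrow> d (e x) = x"
      and d: "\<And>x. x \<in> carrier N \<Longrightarrow> d x \<in> carrier K"
      and e_hom: "\<And>a b. a \<in> ?A \<Longrightarrow> b \<in> ?A \<Longrightarrow> e (imp K a b) = imp N (e a) (e b)"
        "e (tt K) = tt N" "e (ff K) = ff N"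
      and d_hom: "\<And>a b. a \<in> carrier N \<Longrightarrow> b \<in> carrier N \<Longrightarrow> d (imp N a b) = imp K (d a) (d b)"
        "d (tt N) = tt K" "d (ff N) = ff K"
      by (rule countable_nat_copy[OF K A]) (rule that)
    have f': "restrict (e \<circ> f) (carrier H) \<in> bhil_hom H N"
      by (rule bhil_hom_compose[OF f Un_upper1 H(1) e e_hom])
    have g': "restrict (e \<circ> g) (carrier G) \<in> bhil_hom G N"
      by (rule bhil_hom_compose[OF g Un_upper2 G(1) e e_hom])
    obtain h where h: "h \<in> bhil_hom C N"
      "\<forall>a\<in>carrier H. h (\<iota>\<^sub>1 a) = restrict (e \<circ> f) (carrier H) a"
      "\<forall>b\<in>carrier G. h (\<iota>\<^sub>2 b) = restrict (e \<circ> g) (carrier G) b"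
      using univ[OF N f' g'] by blast
    have hc: "h ` carrier C \<subseteq> carrier N"
      using h(1) by (auto simp: bhil_hom_def)
    have "restrict (d \<circ> h) (carrier C) \<in> bhil_hom C K"
      by (rule bhil_hom_compose[OF h(1) hc C' d d_hom])
    then show "\<exists>h. h \<in> bhil_hom C K \<and>
      (\<forall>a\<in>carrier H. h (\<iota>\<^sub>1 a) = f a) \<and> (\<forall>b\<in>carrier G. h (\<iota>\<^sub>2 b) = g b)"
      using h(2,3) de i1c i2c by (intro exI[of _ "restrict (d \<circ> h) (carrier C)"]) simp
  next
    fix h k
    assume h: "h \<in> bhil_hom C K \<and>
        (\<forall>a\<in>carrier H. h (\<iota>\<^sub>1 a) = f a) \<and> (\<forall>b\<in>carrier G. h (\<iota>\<^sub>2 b) = g b)"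
      and k: "k \<in> bhil_hom C K \<and>
        (\<forall>a\<in>carrier H. k (\<iota>\<^sub>1 a) = f a) \<and> (\<forall>b\<in>carrier G. k (\<iota>\<^sub>2 b) = g b)"
    let ?A = "h ` carrier C \<union> k ` carrier C"
    have A: "countable ?A" "?A \<subseteq> carrier K"
      using C h k by (auto simp: bhil_hom_def)
    obtain N :: "nat bhilbert" and e d where N: "bounded_prelinear_hilbert N"
      and e: "\<And>x. x \<in> ?A \<Longrightarrow> e x \<in> carrier N" and de: "\<And>x. x \<in> ?A \<Longrightarrow> d (e x) = x"
      and e_hom: "\<And>a b. a \<in> ?A \<Longrightarrow> b \<in> ?A \<Longrightarrow> e (imp K a b) = imp N (e a) (e b)"
        "e (tt K) = tt N" "e (ff K) = ff N"
      by (rule countable_nat_copy[OF K A]) (rule that)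
    have sub: "f ` carrier H \<subseteq> ?A" "g ` carrier G \<subseteq> ?A"
    proof -
      show "f ` carrier H \<subseteq> ?A"
      proof
        fix y assume "y \<in> f ` carrier H"
        then obtain a where "a \<in> carrier H" "y = h (\<iota>\<^sub>1 a)"
          using h by (metis imageE)
        then show "y \<in> ?A" using i1c by blast
      qed
      show "g ` carrier G \<subseteq> ?A"
      proof
        fix y assume "y \<in> g ` carrier G"
        then obtain b where "b \<in> carrier G" "y = h (\<iota>\<^sub>2 b)"
          using h by (metis imageE)
        then show "y \<in> ?A" using i2c by blast
      qed
    qed
    let ?h = "restrict (e \<circ> h) (carrier C)"
    let ?k = "restrict (e \<circ> k) (carrier C)"
    let ?f = "restrict (e \<circ> f) (carrier H)"
    let ?g = "restrict (e \<circ> g) (carrier G)"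
    have f': "?f \<in> bhil_hom H N"
      by (rule bhil_hom_compose[OF f sub(1) H(1) e e_hom])
    have g': "?g \<in> bhil_hom G N"
      by (rule bhil_hom_compose[OF g sub(2) G(1) e e_hom])
    have h': "?h \<in> bhil_hom C N"
      by (rule bhil_hom_compose[OF conjunct1[OF h] Un_upper1 C' e e_hom])
    have k': "?k \<in> bhil_hom C N"
      by (rule bhil_hom_compose[OF conjunct1[OF k] Un_upper2 C' e e_hom])
    have "?h \<in> bhil_hom C N \<and>
        (\<forall>a\<in>carrier H. ?h (\<iota>\<^sub>1 a) = ?f a) \<and> (\<forall>b\<in>carrier G. ?h (\<iota>\<^sub>2 b) = ?g b)"
      using h h' i1c i2c by simp
    moreover have "?k \<in> bhil_hom C N \<and>
        (\<forall>a\<in>carrier H. ?k (\<iota>\<^sub>1 a) = ?f a) \<and> (\<forall>b\<in>carrier G. ?k (\<iota>\<^sub>2 b) = ?g b)"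
      using k k' i1c i2c by simp
    ultimately have eq: "?h = ?k"
      by (rule ex1_unique[OF univ[OF N f' g']])
    have "h x = k x" if x: "x \<in> carrier C" for x
    proof -
      have "e (h x) = e (k x)"
        using fun_cong[OF eq, of x] x by simp
      moreover have "d (e (h x)) = h x" "d (e (k x)) = k x"
        by (rule de, use x in blast)+
      ultimately show ?thesis
        by metis
    qed
    then show "h = k"
      by (rule extensionalityI[of h "carrier C" k, rotated 2]) (use h k in \<open>simp_all add: bhil_hom_def PiE_def\<close>)
  qed
  then show ?thesis
    using C' i1 i2 unfolding bhil_coproduct_def by blast
qed

end

theory Submission
  imports Defs
begin

text \<open>
  The algebra of the product forest is described through its points, and duality for morphisms is
  replaced by one statement about generation.

  Call a proper implicative filter \<open>P\<close> linear if \<open>a \<rightarrow> b \<in> P\<close> or \<open>b \<rightarrow> a \<in> P\<close> for all \<open>a\<close>, \<open>b\<close>.  In a prelinear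
  algebra the linear filters are the irreducible ones (\<open>irreducible_iff_linear\<close>), they separate
  elements (\<open>linear_filter_separation\<close>), the filters above one of them form a chain, and \<open>a \<rightarrow> b \<in> P\<close>
  iff every linear filter above \<open>P\<close> that contains \<open>a\<close> contains \<open>b\<close> (\<open>imp_mem_linear\<close>).  Linearity,
  unlike irreducibility, visibly passes to preimages under homomorphisms and to larger proper
  filters.

  A point of \<open>X(H) \<otimes> X(G)\<close> is a finite nonempty chain of pairs of such filters whose two projections
  are closed under passing to larger filters, and \<open>\<preceq>\<close> says that one chain is an initial segment of
  the other (\<open>tensor_carrier_eq\<close>, \<open>US_le_iff_initial\<close>).  An element \<open>a\<close> of \<open>H\<close> goes to the set
  \<open>cyl1 H G a\<close> of those chains all of whose first components contain \<open>a\<close>, and likewise for \<open>G\<close>.  The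
  initial segments of a chain are themselves linearly ordered, so an algebra of downsets for this
  order is prelinear (\<open>prelinear_downsets\<close>).

  The heart of the proof is that \<open>cyl1\<close> and \<open>cyl2\<close> together generate the whole algebra
  (\<open>coproduct_generated\<close>).  This gives the uniqueness of mediating homomorphisms at once.  It also
  gives their existence, into an arbitrary, possibly infinite, algebra \<open>K\<close>: a linear filter \<open>P\<close> of \<open>K\<close>
  and homomorphisms \<open>f\<close>, \<open>g\<close> into \<open>K\<close> yield the chain \<open>trace P\<close> of all pairs \<open>(f\<^sup>-\<^sup>1(Q), g\<^sup>-\<^sup>1(Q))\<close> with \<open>Q\<close>
  linear and above \<open>P\<close>.  Taking preimages of filters is an open map (\<open>pullback_open\<close>), so that \<open>trace P\<close>
  is a point of the tensor product and its initial segments are the traces of the filters above \<open>P\<close>.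
  Therefore the sets \<open>U\<close> for which some \<open>k\<close> in \<open>K\<close> satisfies \<open>k \<in> P \<longleftrightarrow> trace P \<in> U\<close> for all \<open>P\<close> are
  closed under implication; they include the generators, hence they are all elements of the algebra,
  and \<open>U \<mapsto> k\<close> is the mediating homomorphism.
\<close>

section \<open>Linear implicative filters\<close>

lemma
  assumes "hilbert_algebra H"
  shows tt_closed: "tt H \<in> carrier H"
    and imp_closed: "a \<in> carrier H \<Longrightarrow> b \<in> carrier H \<Longrightarrow> imp H a b \<in> carrier H"
    and imp_K: "a \<in> carrier H \<Longrightarrow> b \<in> carrier H \<Longrightarrow> imp H a (imp H b a) = tt H"
    and imp_S: "a \<in> carrier H \<Longrightarrow> b \<in> carrier H \<Longrightarrow> c \<in> carrier H \<Longrightarrow>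
      imp H (imp H a (imp H b c)) (imp H (imp H a b) (imp H a c)) = tt H"
    and imp_antisym: "a \<in> carrier H \<Longrightarrow> b \<in> carrier H \<Longrightarrow>
      imp H a b = tt H \<Longrightarrow> imp H b a = tt H \<Longrightarrow> a = b"
  using assms unfolding hilbert_algebra_def by blast+

text \<open>Substituting \<open>1 \<rightarrow> x = 1\<close> into the axiom \<open>x \<rightarrow> (1 \<rightarrow> x) = 1\<close> gives \<open>x \<rightarrow> 1 = 1\<close>, and antisymmetry
  applies.  This is modus ponens for \<open>1\<close>, which makes the singleton \<open>{1}\<close> a filter; equations of the
  algebra can then be derived as membership statements about filters.\<close>

lemma tt_imp_cancel:
  assumes H: "hilbert_algebra H" and x: "x \<in> carrier H" and eq: "imp H (tt H) x = tt H"
  shows "x = tt H"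
proof (rule imp_antisym[OF H x tt_closed[OF H] _ eq])
  show "imp H x (tt H) = tt H"
    using imp_K[OF H x tt_closed[OF H]] eq by simp
qed

lemma implicative_filter_tt:
  assumes "hilbert_algebra H"
  shows "implicative_filter H {tt H}"
  unfolding implicative_filter_def using tt_closed[OF assms] tt_imp_cancel[OF assms] by auto

lemma
  assumes "implicative_filter H F"
  shows filter_subset: "F \<subseteq> carrier H"
    and filter_tt: "tt H \<in> F"
    and filter_mp: "a \<in> F \<Longrightarrow> imp H a b \<in> F \<Longrightarrow> b \<in> carrier H \<Longrightarrow> b \<in> F"
  using assms unfolding implicative_filter_def by blast+

lemma filter_K:
  assumes H: "hilbert_algebra H" and F: "implicative_filter H F" and "b \<in> F" "a \<in> carrier H"
  shows "imp H a b \<in> F"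
proof -
  have b: "b \<in> carrier H"
    using filter_subset[OF F] assms(3) by auto
  show ?thesis
    by (rule filter_mp[OF F assms(3)])
      (simp_all add: imp_K[OF H b assms(4)] filter_tt[OF F] imp_closed[OF H] b assms(4))
qed

lemma filter_S:
  assumes H: "hilbert_algebra H" and F: "implicative_filter H F"
    and c: "a \<in> carrier H" "b \<in> carrier H" "c \<in> carrier H"
    and "imp H a (imp H b c) \<in> F" "imp H a b \<in> F"
  shows "imp H a c \<in> F"
proof -
  have "imp H (imp H a b) (imp H a c) \<in> F"
    by (rule filter_mp[OF F assms(6)])
      (simp_all add: imp_S[OF H c] filter_tt[OF F] imp_closed[OF H] c)
  then show ?thesis
    by (rule filter_mp[OF F assms(7)]) (simp add: imp_closed[OF H] c)
qed

lemma imp_refl: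
  assumes H: "hilbert_algebra H" and a: "a \<in> carrier H"
  shows "imp H a a = tt H"
proof -
  have "imp H a a \<in> {tt H}"
    by (rule filter_S[OF H implicative_filter_tt[OF H] a imp_closed[OF H a a] a])
      (simp_all add: imp_K[OF H] a imp_closed[OF H])
  then show ?thesis by simp
qed

lemma filter_trans:
  assumes H: "hilbert_algebra H" and F: "implicative_filter H F"
    and c: "a \<in> carrier H" "b \<in> carrier H" "c \<in> carrier H"
    and "imp H a b \<in> F" "imp H b c \<in> F"
  shows "imp H a c \<in> F"
  by (rule filter_S[OF H F c filter_K[OF H F assms(7) c(1)] assms(6)])

text \<open>The implicative filter generated by a filter \<open>F\<close> and one more element \<open>a\<close>.\<close>

definition adjoin :: "('a, 'm) hilbert_scheme \<Rightarrow> 'a set \<Rightarrow> 'a \<Rightarrow> 'a set" where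
  "adjoin H F a = {x \<in> carrier H. imp H a x \<in> F}"

lemma
  assumes H: "hilbert_algebra H" and F: "implicative_filter H F" and a: "a \<in> carrier H"
  shows implicative_filter_adjoin: "implicative_filter H (adjoin H F a)"
    and adjoin_superset: "F \<subseteq> adjoin H F a"
    and adjoin_mem: "a \<in> adjoin H F a"
proof -
  show "F \<subseteq> adjoin H F a"
    using filter_K[OF H F _ a] filter_subset[OF F] unfolding adjoin_def by auto
  then show "implicative_filter H (adjoin H F a)"
    unfolding implicative_filter_def using filter_tt[OF F] filter_S[OF H F a]
    unfolding adjoin_def by blast
  show "a \<in> adjoin H F a"
    unfolding adjoin_def using a imp_refl[OF H a] filter_tt[OF F] by simp
qed

definition linear_filter :: "('a, 'm) hilbert_scheme \<Rightarrow> 'a set \<Rightarrow> bool" where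
  "linear_filter H P \<longleftrightarrow> implicative_filter H P \<and> P \<noteq> carrier H \<and>
     (\<forall>a\<in>carrier H. \<forall>b\<in>carrier H. imp H a b \<in> P \<or> imp H b a \<in> P)"

lemma linear_filterD:
  assumes "linear_filter H P"
  shows "implicative_filter H P" "P \<noteq> carrier H"
    "a \<in> carrier H \<Longrightarrow> b \<in> carrier H \<Longrightarrow> imp H a b \<in> P \<or> imp H b a \<in> P"
  using assms unfolding linear_filter_def by blast+

lemma linear_filter_mono:
  assumes "linear_filter H P" "implicative_filter H F" "P \<subseteq> F" "F \<noteq> carrier H"
  shows "linear_filter H F"
  using assms unfolding linear_filter_def by blast

lemma filters_above_linear_chain:
  assumes P: "linear_filter H P"
    and F: "implicative_filter H E" "P \<subseteq> E" and F': "implicative_filter H F" "P \<subseteq> F"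
  shows "E \<subseteq> F \<or> F \<subseteq> E"
proof (rule ccontr)
  assume "\<not> ?thesis"
  then obtain a b where ab: "a \<in> E" "a \<notin> F" "b \<in> F" "b \<notin> E"
    by blast
  then have c: "a \<in> carrier H" "b \<in> carrier H"
    using filter_subset[OF F(1)] filter_subset[OF F'(1)] by auto
  show False
    using linear_filterD(3)[OF P c]
    using filter_mp[OF F(1) ab(1) _ c(2)] filter_mp[OF F'(1) ab(3) _ c(1)] F(2) F'(2) ab by blast
qed

text \<open>The filter generated by \<open>P\<close> and \<open>a\<close> is again linear as soon as it is proper, so that it serves as
  the test filter.\<close>

lemma imp_mem_linear:
  assumes H: "hilbert_algebra H" and P: "linear_filter H P"
    and c: "a \<in> carrier H" "b \<in> carrier H"
  shows "imp H a b \<in> P \<longleftrightarrow> (\<forall>Q. linear_filter H Q \<and> P \<subseteq> Q \<longrightarrow> a \<in> Q \<longrightarrow> b \<in> Q)"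
proof
  assume "imp H a b \<in> P"
  then show "\<forall>Q. linear_filter H Q \<and> P \<subseteq> Q \<longrightarrow> a \<in> Q \<longrightarrow> b \<in> Q"
    using filter_mp[OF linear_filterD(1) _ _ c(2)] by blast
next
  assume R: "\<forall>Q. linear_filter H Q \<and> P \<subseteq> Q \<longrightarrow> a \<in> Q \<longrightarrow> b \<in> Q"
  note F = implicative_filter_adjoin[OF H linear_filterD(1)[OF P] c(1)]
    adjoin_superset[OF H linear_filterD(1)[OF P] c(1)]
    adjoin_mem[OF H linear_filterD(1)[OF P] c(1)]
  have "b \<in> adjoin H P a"
  proof (cases "adjoin H P a = carrier H")
    case False
    then show ?thesis
      using R F linear_filter_mono[OF P F(1,2)] by blast
  qed (use c in simp)
  then show "imp H a b \<in> P"
    by (simp add: adjoin_def)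
qed

text \<open>The identity \<open>((a \<rightarrow> b) \<rightarrow> c) \<rightarrow> (((b \<rightarrow> a) \<rightarrow> c) \<rightarrow> c) = 1\<close> is the form in which
  prelinearity enters: what follows both from \<open>a \<rightarrow> b\<close> and from \<open>b \<rightarrow> a\<close> holds.\<close>

lemma chain_identity_prelinear:
  "chain_identity
     (Imp (Imp (Imp (Var 0) (Var 1)) (Var 2)) (Imp (Imp (Imp (Var 1) (Var 0)) (Var 2)) (Var 2))) One"
  unfolding chain_identity_def satisfies_def
proof (intro allI impI)
  fix C :: "nat hilbert" and v :: "nat \<Rightarrow> nat"
  assume "hilbert_chain C" and v: "\<forall>i. v i \<in> carrier C"
  then have C: "hilbert_algebra C" and
    lin: "imp C (v 0) (v 1) = tt C \<or> imp C (v 1) (v 0) = tt C"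
    unfolding hilbert_chain_def hil_le_def by auto
  note F = implicative_filter_tt[OF C]
  have tt_imp: "imp C (tt C) (v 2) = v 2"
  proof (rule imp_antisym[OF C])
    show "imp C (imp C (tt C) (v 2)) (v 2) = tt C"
      using filter_S[OF C F, of "imp C (tt C) (v 2)" "tt C" "v 2"]
        filter_K[OF C F, of "tt C" "imp C (tt C) (v 2)"] imp_refl[OF C, of "imp C (tt C) (v 2)"]
      by (simp add: v imp_closed[OF C] tt_closed[OF C])
  qed (simp_all add: v imp_closed[OF C] tt_closed[OF C] imp_K[OF C])
  have triv: "imp C (v 2) (v 2) = tt C" "\<And>x. x \<in> carrier C \<Longrightarrow> imp C x (tt C) = tt C"
    using imp_refl[OF C] filter_K[OF C F, of "tt C"] v by auto
  show "eval C v (Imp (Imp (Imp (Var 0) (Var 1)) (Var 2))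
      (Imp (Imp (Imp (Var 1) (Var 0)) (Var 2)) (Var 2))) = eval C v One"
    using lin by (auto simp: tt_imp triv v imp_closed[OF C] imp_K[OF C])
qed

lemma prelinear_cases:
  assumes H: "prelinear_hilbert H" and F: "implicative_filter H F"
    and c: "a \<in> carrier H" "b \<in> carrier H" "c \<in> carrier H"
    and "imp H (imp H a b) c \<in> F" "imp H (imp H b a) c \<in> F"
  shows "c \<in> F"
proof -
  have A: "hilbert_algebra H"
    using H by (simp add: prelinear_hilbert_def)
  have "satisfies H (Imp (Imp (Imp (Var 0) (Var 1)) (Var 2))
      (Imp (Imp (Imp (Var 1) (Var 0)) (Var 2)) (Var 2))) One"
    using H chain_identity_prelinear by (simp add: prelinear_hilbert_def)
  from this[unfolded satisfies_def, rule_format, of "\<lambda>i. if i = 0 then a else if i = 1 then b else c"]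
  have "imp H (imp H (imp H a b) c) (imp H (imp H (imp H b a) c) c) \<in> F"
    using c filter_tt[OF F] by simp
  with assms(6) have "imp H (imp H (imp H b a) c) c \<in> F"
    by (rule filter_mp[OF F]) (simp add: c imp_closed[OF A])
  with assms(7) show ?thesis
    by (rule filter_mp[OF F]) (rule c(3))
qed

lemma irreducible_iff_linear:
  assumes H: "prelinear_hilbert H"
  shows "irreducible_filter H P \<longleftrightarrow> linear_filter H P"
proof
  have A: "hilbert_algebra H"
    using H by (simp add: prelinear_hilbert_def)
  assume P: "irreducible_filter H P"
  then have F: "implicative_filter H P"
    by (simp add: irreducible_filter_def)
  have "imp H a b \<in> P \<or> imp H b a \<in> P" if c: "a \<in> carrier H" "b \<in> carrier H" for a b
  proof (rule ccontr)
    let ?E = "adjoin H P (imp H a b)" and ?F = "adjoin H P (imp H b a)"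
    assume "\<not> ?thesis"
    then have "P \<noteq> ?E" "P \<noteq> ?F"
      using adjoin_mem[OF A F] imp_closed[OF A] c by blast+
    moreover have "implicative_filter H ?E" "implicative_filter H ?F" "P \<subseteq> ?E" "P \<subseteq> ?F"
      using implicative_filter_adjoin[OF A F] adjoin_superset[OF A F] imp_closed[OF A] c by blast+
    ultimately obtain x where "x \<in> ?E" "x \<in> ?F" "x \<notin> P"
      using P unfolding irreducible_filter_def by blast
    then show False
      using prelinear_cases[OF H F c] unfolding adjoin_def by blast
  qed
  then show "linear_filter H P"
    using P unfolding irreducible_filter_def linear_filter_def by blast
next
  assume P: "linear_filter H P"
  show "irreducible_filter H P"
    unfolding irreducible_filter_def
  proof (intro conjI allI impI)
    fix E F assume "implicative_filter H E \<and> implicative_filter H F \<and> P = E \<inter> F"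
    then show "P = E \<or> P = F"
      using filters_above_linear_chain[OF P, of E F] by blast
  qed (use linear_filterD[OF P] in auto)
qed

text \<open>A filter maximal among those that contain \<open>a\<close> and omit \<open>b\<close> is linear: if it omitted both \<open>x \<rightarrow> y\<close> and
  \<open>y \<rightarrow> x\<close>, then by maximality it would contain \<open>(x \<rightarrow> y) \<rightarrow> b\<close> and \<open>(y \<rightarrow> x) \<rightarrow> b\<close>, and therefore \<open>b\<close>.\<close>

lemma linear_filter_separation:
  assumes H: "prelinear_hilbert H" and c: "a \<in> carrier H" "b \<in> carrier H"
    and ne: "imp H a b \<noteq> tt H"
  obtains P where "linear_filter H P" "a \<in> P" "b \<notin> P"
proof -
  have A: "hilbert_algebra H"
    using H by (simp add: prelinear_hilbert_def)
  define \<F> where "\<F> = {F. implicative_filter H F \<and> a \<in> F \<and> b \<notin> F}"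
  note T = implicative_filter_tt[OF A]
  have "adjoin H {tt H} a \<in> \<F>"
    using implicative_filter_adjoin[OF A T c(1)] adjoin_mem[OF A T c(1)] ne
    unfolding \<F>_def by (simp add: adjoin_def)
  then have "\<F> \<noteq> {}"
    by blast
  moreover have "\<Union>\<C> \<in> \<F>" if \<C>: "\<C> \<noteq> {}" "subset.chain \<F> \<C>" for \<C>
  proof -
    have sub: "\<C> \<subseteq> \<F>" and lin: "\<And>E F. E \<in> \<C> \<Longrightarrow> F \<in> \<C> \<Longrightarrow> E \<subseteq> F \<or> F \<subseteq> E"
      using \<C>(2) unfolding subset.chain_def by blast+
    have "y \<in> \<Union>\<C>" if xy: "x \<in> \<Union>\<C>" "imp H x y \<in> \<Union>\<C>" "y \<in> carrier H" for x y
    proof -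
      obtain E F where EF: "E \<in> \<C>" "F \<in> \<C>" "x \<in> E" "imp H x y \<in> F"
        using xy by blast
      then obtain D where D: "D \<in> \<C>" "x \<in> D" "imp H x y \<in> D"
        using lin[OF EF(1,2)] by blast
      then have "implicative_filter H D"
        using sub unfolding \<F>_def by blast
      then show ?thesis
        using filter_mp[OF _ D(2,3) xy(3)] D(1) by blast
    qed
    then have "implicative_filter H (\<Union>\<C>)"
      using sub \<C>(1) filter_subset filter_tt unfolding implicative_filter_def \<F>_def by blast
    then show ?thesis
      using sub \<C>(1) unfolding \<F>_def by blast
  qed
  ultimately obtain P where P: "P \<in> \<F>" and max: "\<And>F. F \<in> \<F> \<Longrightarrow> P \<subseteq> F \<Longrightarrow> F = P"
    using subset_Zorn_nonempty[of \<F>] by blast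
  have F: "implicative_filter H P" "a \<in> P" "b \<notin> P"
    using P unfolding \<F>_def by auto
  have mem: "imp H x b \<in> P" if x: "x \<in> carrier H" "x \<notin> P" for x
  proof (rule ccontr)
    assume "imp H x b \<notin> P"
    then have "adjoin H P x \<in> \<F>"
      using implicative_filter_adjoin[OF A F(1) x(1)] adjoin_superset[OF A F(1) x(1)] F
      unfolding \<F>_def by (auto simp: adjoin_def)
    then show False
      using max adjoin_superset[OF A F(1) x(1)] adjoin_mem[OF A F(1) x(1)] x(2) by blast
  qed
  have "imp H x y \<in> P \<or> imp H y x \<in> P" if xy: "x \<in> carrier H" "y \<in> carrier H" for x y
    using prelinear_cases[OF H F(1) xy c(2)] mem imp_closed[OF A] xy F(3) by blast
  then have "linear_filter H P"
    unfolding linear_filter_def using F c(2) by blast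
  then show ?thesis
    using that F by blast
qed

lemma linear_filter_eqI:
  assumes H: "prelinear_hilbert H" and c: "a \<in> carrier H" "b \<in> carrier H"
    and "\<And>P. linear_filter H P \<Longrightarrow> a \<in> P \<longleftrightarrow> b \<in> P"
  shows "a = b"
proof (rule imp_antisym)
  show "hilbert_algebra H"
    using H by (simp add: prelinear_hilbert_def)
  show "imp H a b = tt H"
    using linear_filter_separation[OF H c] assms(4) by blast
  show "imp H b a = tt H"
    using linear_filter_separation[OF H c(2,1)] assms(4) by blast
qed (rule c)+

lemma
  assumes "bounded_prelinear_hilbert H"
  shows bounded_prelinear: "prelinear_hilbert H"
    and bounded_hilbert: "hilbert_algebra H"
    and ff_closed: "ff H \<in> carrier H"
  using assms unfolding bounded_prelinear_hilbert_def prelinear_hilbert_def by auto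

lemma ff_notin_proper:
  assumes H: "bounded_prelinear_hilbert H" and F: "implicative_filter H F"
  shows "F \<noteq> carrier H \<longleftrightarrow> ff H \<notin> F"
proof -
  have "a \<in> F" if "ff H \<in> F" "a \<in> carrier H" for a
  proof -
    have "imp H (ff H) a = tt H"
      using H that(2) unfolding bounded_prelinear_hilbert_def hil_le_def by blast
    then show ?thesis
      using filter_mp[OF F that(1) _ that(2)] filter_tt[OF F] by simp
  qed
  then show ?thesis
    using filter_subset[OF F] ff_closed[OF H] by blast
qed

lemma bhil_homD:
  assumes "f \<in> bhil_hom H K"
  shows "a \<in> carrier H \<Longrightarrow> f a \<in> carrier K"
    "a \<in> carrier H \<Longrightarrow> b \<in> carrier H \<Longrightarrow> f (imp H a b) = imp K (f a) (f b)"
    "f (tt H) = tt K" "f (ff H) = ff K"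
  using assms unfolding bhil_hom_def by auto

definition pullback :: "'a bhilbert \<Rightarrow> ('a \<Rightarrow> 'b) \<Rightarrow> 'b set \<Rightarrow> 'a set" where
  "pullback H f P = {a \<in> carrier H. f a \<in> P}"

lemma linear_filter_pullback:
  assumes H: "bounded_prelinear_hilbert H" and K: "bounded_prelinear_hilbert K"
    and f: "f \<in> bhil_hom H K" and P: "linear_filter K P"
  shows "linear_filter H (pullback H f P)"
proof -
  note F = linear_filterD(1)[OF P]
  have filt: "implicative_filter H (pullback H f P)"
    unfolding implicative_filter_def
  proof (intro conjI ballI impI)
    show "tt H \<in> pullback H f P"
      using filter_tt[OF F] tt_closed[OF bounded_hilbert[OF H]]
      by (simp add: pullback_def bhil_homD(3)[OF f])
    fix a b assume "a \<in> carrier H" "b \<in> carrier H"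
      "a \<in> pullback H f P \<and> imp H a b \<in> pullback H f P"
    then show "b \<in> pullback H f P"
      using filter_mp[OF F, of "f a" "f b"] by (simp add: pullback_def bhil_homD(1,2)[OF f])
  qed (auto simp: pullback_def)
  moreover have "pullback H f P \<noteq> carrier H"
    using ff_notin_proper[OF H filt] ff_notin_proper[OF K F] linear_filterD(2)[OF P]
    by (simp add: pullback_def bhil_homD[OF f])
  ultimately show ?thesis
    using linear_filterD(3)[OF P] bhil_homD[OF f] imp_closed[OF bounded_hilbert[OF H]]
    unfolding linear_filter_def pullback_def by simp
qed

text \<open>The filter of \<open>K\<close> generated by \<open>P\<close> and the image of \<open>M\<close> pulls back to \<open>M\<close> itself: if \<open>f m \<rightarrow> f a \<in> P\<close> with
  \<open>m \<in> M\<close>, then \<open>m \<rightarrow> a\<close> lies in the pullback of \<open>P\<close>, hence in \<open>M\<close>, and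
  so does \<open>a\<close> by modus ponens.\<close>

lemma pullback_open:
  assumes H: "bounded_prelinear_hilbert H" and K: "bounded_prelinear_hilbert K"
    and f: "f \<in> bhil_hom H K" and P: "linear_filter K P"
    and M: "linear_filter H M" "pullback H f P \<subseteq> M"
  obtains Q where "linear_filter K Q" "P \<subseteq> Q" "pullback H f Q = M"
proof -
  note AH = bounded_hilbert[OF H] and AK = bounded_hilbert[OF K]
  note F = linear_filterD(1)[OF P] and FM = linear_filterD(1)[OF M(1)]
  have Mc: "m \<in> carrier H" "f m \<in> carrier K" if "m \<in> M" for m
    using that filter_subset[OF FM] bhil_homD(1)[OF f] by auto
  define Q where "Q = {x \<in> carrier K. \<exists>m\<in>M. imp K (f m) x \<in> P}"
  have "P \<subseteq> Q"
  proof
    fix x assume x: "x \<in> P"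
    then have "imp K (f (tt H)) x \<in> P"
      using filter_K[OF AK F _ Mc(2)[OF filter_tt[OF FM]]] by blast
    then show "x \<in> Q"
      using x filter_subset[OF F] filter_tt[OF FM] unfolding Q_def by blast
  qed
  moreover have "y \<in> Q" if xy: "x \<in> Q" "imp K x y \<in> Q" "y \<in> carrier K" for x y
  proof -
    obtain m n where mn: "m \<in> M" "n \<in> M" "imp K (f m) x \<in> P" "imp K (f n) (imp K x y) \<in> P"
      and x: "x \<in> carrier K"
      using xy unfolding Q_def by blast
    note c = Mc(2)[OF mn(1)] Mc(2)[OF mn(2)] x xy(3) imp_closed[OF AK x xy(3)]
    \<comment> \<open>linearity makes one of the two witnesses serve for both premises\<close>
    have "\<exists>k\<in>M. imp K (f k) x \<in> P \<and> imp K (f k) (imp K x y) \<in> P"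
      using linear_filterD(3)[OF P c(1,2)] filter_trans[OF AK F] mn c by blast
    then show ?thesis
      using filter_S[OF AK F _ x xy(3)] Mc xy(3) unfolding Q_def by blast
  qed
  ultimately have Q: "implicative_filter K Q"
    using filter_tt[OF F] unfolding implicative_filter_def Q_def by blast
  have eq: "pullback H f Q = M"
  proof
    show "pullback H f Q \<subseteq> M"
    proof
      fix a assume "a \<in> pullback H f Q"
      then obtain m where m: "a \<in> carrier H" "m \<in> M" "imp K (f m) (f a) \<in> P"
        unfolding pullback_def Q_def by blast
      then have "imp H m a \<in> pullback H f P"
        using bhil_homD(2)[OF f] Mc imp_closed[OF AH] unfolding pullback_def by simp
      then show "a \<in> M"
        using filter_mp[OF FM m(2) _ m(1)] M(2) by blast
    qed
    show "M \<subseteq> pullback H f Q"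
      using imp_refl[OF AK] filter_tt[OF F] Mc unfolding pullback_def Q_def by force
  qed
  have "Q \<noteq> carrier K"
  proof
    assume "Q = carrier K"
    then have "M = carrier H"
      using eq bhil_homD(1)[OF f] unfolding pullback_def by blast
    then show False
      using linear_filterD(2)[OF M(1)] by simp
  qed
  then show ?thesis
    using that linear_filter_mono[OF P Q] eq \<open>P \<subseteq> Q\<close> by blast
qed

section \<open>Algebras of downsets of a forest\<close>

text \<open>An identity may be checked at one point \<open>x\<close> at a time.  Restricting downsets to the chain \<open>D\<close> of the
  points below \<open>x\<close> is a homomorphism into the Hilbert chain of all downsets of \<open>D\<close>, and in
  the latter all chain identities hold.\<close>

lemma prelinear_downsets:
  fixes A :: "('z set, 'm) hilbert_scheme" and le :: "'z \<Rightarrow> 'z \<Rightarrow> bool"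
  assumes refl: "\<And>x. x \<in> Z \<Longrightarrow> le x x"
    and trans: "\<And>x y z. x \<in> Z \<Longrightarrow> y \<in> Z \<Longrightarrow> z \<in> Z \<Longrightarrow> le x y \<Longrightarrow> le y z \<Longrightarrow> le x z"
    and forest: "\<And>x y z. x \<in> Z \<Longrightarrow> y \<in> Z \<Longrightarrow> z \<in> Z \<Longrightarrow> le x z \<Longrightarrow> le y z \<Longrightarrow> le x y \<or> le y x"
    and sub: "\<And>U. U \<in> carrier A \<Longrightarrow> U \<subseteq> Z"
    and down: "\<And>U x y. U \<in> carrier A \<Longrightarrow> x \<in> U \<Longrightarrow> y \<in> Z \<Longrightarrow> le y x \<Longrightarrow> y \<in> U"
    and top: "tt A = Z" "Z \<in> carrier A"
    and closed: "\<And>U V. U \<in> carrier A \<Longrightarrow> V \<in> carrier A \<Longrightarrow> imp A U V \<in> carrier A"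
    and impl: "\<And>U V. U \<in> carrier A \<Longrightarrow> V \<in> carrier A \<Longrightarrow>
      imp A U V = {z \<in> Z. \<forall>y\<in>Z. le y z \<longrightarrow> y \<in> U \<longrightarrow> y \<in> V}"
  shows "prelinear_hilbert A"
proof -
  have eq_top: "imp A U V = Z \<longleftrightarrow> U \<subseteq> V" if "U \<in> carrier A" "V \<in> carrier A" for U V
    using that sub[OF that(1)] refl by (auto simp: impl)
  have mem: "z \<in> imp A U V \<longleftrightarrow> z \<in> Z \<and> (\<forall>y\<in>Z. le y z \<longrightarrow> y \<in> U \<longrightarrow> y \<in> V)"
    if "U \<in> carrier A" "V \<in> carrier A" for U V z
    unfolding impl[OF that] by simp
  have A: "hilbert_algebra A"
    unfolding hilbert_algebra_def top(1)
  proof (intro conjI ballI impI top(2))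
    fix U V assume c: "U \<in> carrier A" "V \<in> carrier A"
    show "imp A U V \<in> carrier A"
      by (rule closed[OF c])
    show "imp A U (imp A V U) = Z"
      using eq_top[OF c(1) closed[OF c(2,1)]] impl[OF c(2,1)] down[OF c(1)] sub[OF c(1)] by blast
    show "imp A U V = Z \<and> imp A V U = Z \<Longrightarrow> U = V"
      using eq_top c by blast
    fix W assume W: "W \<in> carrier A"
    have "imp A U (imp A V W) \<subseteq> imp A (imp A U V) (imp A U W)"
    proof
      fix x assume x: "x \<in> imp A U (imp A V W)"
      have "z \<in> W" if *: "y \<in> Z" "le y x" "y \<in> imp A U V" "z \<in> Z" "le z y" "z \<in> U" for y z
      proof -
        have "le z x"
          using trans[OF *(4,1) _ *(5,2)] x by (simp add: mem closed c W)
        then have "z \<in> imp A V W"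
          using x * by (simp add: mem closed c W)
        moreover have "z \<in> V"
          using * by (simp add: mem c)
        ultimately show ?thesis
          using refl[OF *(4)] *(4) by (simp add: mem c W)
      qed
      then show "x \<in> imp A (imp A U V) (imp A U W)"
        using x by (simp add: mem closed c W)
    qed
    then show "imp A (imp A U (imp A V W)) (imp A (imp A U V) (imp A U W)) = Z"
      by (simp add: eq_top closed c W)
  qed
  moreover have "satisfies A s t" if st: "chain_identity s t" for s t
    unfolding satisfies_def
  proof (intro allI impI)
    fix v :: "nat \<Rightarrow> 'z set"
    assume v: "\<forall>i. v i \<in> carrier A"
    have ev: "eval A v r \<in> carrier A" for r
      by (induction r) (simp_all add: v top closed)
    have "x \<in> eval A v s \<longleftrightarrow> x \<in> eval A v t" if x: "x \<in> Z" for x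
    proof -
      define D where "D = {y \<in> Z. le y x}"
      define C where "C = \<lparr>carrier = {U. U \<subseteq> D \<and> (\<forall>u\<in>U. \<forall>y\<in>D. le y u \<longrightarrow> y \<in> U)},
        imp = (\<lambda>U V. if U \<subseteq> V then D else V), tt = D\<rparr>"
      have lin: "U \<subseteq> V \<or> V \<subseteq> U" if "U \<in> carrier C" "V \<in> carrier C" for U V
      proof (rule ccontr)
        assume "\<not> ?thesis"
        then obtain p q where pq: "p \<in> U" "p \<notin> V" "q \<in> V" "q \<notin> U"
          by blast
        then have "p \<in> D" "q \<in> D"
          using that by (auto simp: C_def)
        then have "le p q \<or> le q p"
          using forest[of p q x] x by (auto simp: D_def)
        then show False
          using that pq \<open>p \<in> D\<close> \<open>q \<in> D\<close> unfolding C_def by auto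
      qed
      have "hilbert_algebra C"
        using lin unfolding hilbert_algebra_def C_def by auto
      then have chain: "hilbert_chain C"
        using lin unfolding hilbert_chain_def hil_le_def by (auto simp: C_def)
      have car: "U \<inter> D \<in> carrier C" if "U \<in> carrier A" for U
        using down[OF that] by (auto simp: C_def D_def)
      have restr: "imp A U V \<inter> D = imp C (U \<inter> D) (V \<inter> D)"
        if c: "U \<in> carrier A" "V \<in> carrier A" for U V
      proof (cases "U \<inter> D \<subseteq> V \<inter> D")
        case True
        then show ?thesis
          using trans[OF _ _ x] unfolding impl[OF c] C_def D_def by auto
      next
        case False
        then obtain p where p: "p \<in> U" "p \<in> Z" "le p x" "p \<notin> V"
          using sub[OF c(1)] unfolding D_def by blast
        have "y \<in> V" if y: "y \<in> imp A U V" "y \<in> D" for y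
        proof -
          have yZ: "y \<in> Z" "le y x"
            using y by (auto simp: D_def)
          then consider "le y p" | "le p y"
            using forest[OF _ p(2) x] p(3) by blast
          then show ?thesis
          proof cases
            case 1
            then show ?thesis
              using down[OF c(1) p(1) yZ(1)] y(1) refl[OF yZ(1)] yZ(1) unfolding impl[OF c] by blast
          next
            case 2
            then show ?thesis
              using y(1) p unfolding impl[OF c] by blast
          qed
        qed
        moreover have "V \<inter> D \<subseteq> imp A U V"
          using down[OF c(2)] unfolding impl[OF c] D_def by blast
        ultimately show ?thesis
          using False by (auto simp: C_def)
      qed
      have ev_eq: "eval A v r \<inter> D = eval C (\<lambda>i. v i \<inter> D) r" for r
      proof (induction r)
        case One
        show ?case by (auto simp: top(1) C_def D_def)
      next
        case (Imp r s)
        then show ?case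
          using restr[OF ev ev] by simp
      qed simp
      have "eval C (\<lambda>i. v i \<inter> D) s = eval C (\<lambda>i. v i \<inter> D) t"
        by (rule chain_identity_all_types[OF st chain, unfolded satisfies_def, rule_format])
          (simp add: car v)
      then have "eval A v s \<inter> D = eval A v t \<inter> D"
        unfolding ev_eq .
      moreover have "x \<in> D"
        using x refl[OF x] by (simp add: D_def)
      ultimately show ?thesis
        by blast
    qed
    then show "eval A v s = eval A v t"
      using sub[OF ev[of s]] sub[OF ev[of t]] by blast
  qed
  ultimately show ?thesis
    unfolding prelinear_hilbert_def by blast
qed

section \<open>Paths of pairs of filters\<close>

text \<open>The product order on pairs of filters, each coordinate being ordered by reverse inclusion: larger
  filters come first.\<close>

definition pair_le :: "'a set \<times> 'b set \<Rightarrow> 'a set \<times> 'b set \<Rightarrow> bool" where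
  "pair_le r s \<longleftrightarrow> fst s \<subseteq> fst r \<and> snd s \<subseteq> snd r"

lemma pair_le_refl [simp]: "pair_le r r"
  by (simp add: pair_le_def)

lemma pair_le_trans: "pair_le r s \<Longrightarrow> pair_le s t \<Longrightarrow> pair_le r t"
  by (auto simp: pair_le_def)

lemma pair_le_antisym: "pair_le r s \<Longrightarrow> pair_le s r \<Longrightarrow> r = s"
  by (auto simp: pair_le_def prod_eq_iff)

lemma finite_chain_greatest:
  assumes "finite p" "p \<noteq> {}" "\<And>r s. r \<in> p \<Longrightarrow> s \<in> p \<Longrightarrow> R r s \<or> R s r"
    and trans: "\<And>r s t. R r s \<Longrightarrow> R s t \<Longrightarrow> R r t"
  shows "\<exists>m\<in>p. \<forall>r\<in>p. R r m"
  using assms(1-3)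
proof (induction p rule: finite_ne_induct)
  case (insert x F)
  then obtain m where m: "m \<in> F" "\<forall>r\<in>F. R r m"
    by blast
  show ?case
  proof (cases "R x m")
    case False
    then have "R m x" "R x x"
      using insert.prems m(1) by blast+
    then show ?thesis
      using m(2) trans by blast
  qed (use m in blast)
qed blast

text \<open>Initial segments, which turn out to be the order \<open>\<preceq>\<close> of the tensor product.\<close>

definition initial :: "('a set \<times> 'b set) set \<Rightarrow> ('a set \<times> 'b set) set \<Rightarrow> bool" where
  "initial p q \<longleftrightarrow> p \<subseteq> q \<and> (\<forall>r\<in>q. \<forall>s\<in>p. pair_le r s \<longrightarrow> r \<in> p)"

lemma initial_refl [simp]: "initial p p"
  by (simp add: initial_def)

lemma initial_trans: "initial p q \<Longrightarrow> initial q r \<Longrightarrow> initial p r"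
  unfolding initial_def by blast

text \<open>The points of the tensor product, described without enumerating them as increasing lists.  The
  requirement that the first element of the list be minimal is implicit: its coordinates are
  maximal among the irreducible filters because both projections of \<open>p\<close> are closed under passing to
  larger filters.\<close>

definition paths ::
  "('a, 'm) hilbert_scheme \<Rightarrow> ('b, 'n) hilbert_scheme \<Rightarrow> ('a set \<times> 'b set) set set" where
  "paths H G = {p. finite p \<and> p \<noteq> {} \<and> p \<subseteq> irr_filters H \<times> irr_filters G \<and>
     (\<forall>r\<in>p. \<forall>s\<in>p. pair_le r s \<or> pair_le s r) \<and>
     (\<forall>r\<in>p. \<forall>F\<in>irr_filters H. fst r \<subseteq> F \<longrightarrow> F \<in> fst ` p) \<and>
     (\<forall>r\<in>p. \<forall>F\<in>irr_filters G. snd r \<subseteq> F \<longrightarrow> F \<in> snd ` p)}"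

lemma
  assumes "p \<in> paths H G"
  shows path_finite: "finite p" and path_nonempty: "p \<noteq> {}"
    and path_subset: "p \<subseteq> irr_filters H \<times> irr_filters G"
    and path_chain: "r \<in> p \<Longrightarrow> s \<in> p \<Longrightarrow> pair_le r s \<or> pair_le s r"
    and path_down1: "r \<in> p \<Longrightarrow> F \<in> irr_filters H \<Longrightarrow> fst r \<subseteq> F \<Longrightarrow> F \<in> fst ` p"
    and path_down2: "r \<in> p \<Longrightarrow> F' \<in> irr_filters G \<Longrightarrow> snd r \<subseteq> F' \<Longrightarrow> F' \<in> snd ` p"
proof -
  note p = assms[unfolded paths_def mem_Collect_eq]
  show "finite p" "p \<noteq> {}" "p \<subseteq> irr_filters H \<times> irr_filters G"
    using p by simp_all
  have "\<forall>r\<in>p. \<forall>s\<in>p. pair_le r s \<or> pair_le s r"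
    using p by (elim conjE)
  then show "r \<in> p \<Longrightarrow> s \<in> p \<Longrightarrow> pair_le r s \<or> pair_le s r"
    by simp
  have "\<forall>r\<in>p. \<forall>F\<in>irr_filters H. fst r \<subseteq> F \<longrightarrow> F \<in> fst ` p"
    using p by (elim conjE)
  then show "r \<in> p \<Longrightarrow> F \<in> irr_filters H \<Longrightarrow> fst r \<subseteq> F \<Longrightarrow> F \<in> fst ` p"
    by simp
  have "\<forall>r\<in>p. \<forall>F\<in>irr_filters G. snd r \<subseteq> F \<longrightarrow> F \<in> snd ` p"
    using p by (elim conjE)
  then show "r \<in> p \<Longrightarrow> F' \<in> irr_filters G \<Longrightarrow> snd r \<subseteq> F' \<Longrightarrow> F' \<in> snd ` p"
    by simp
qed

lemma path_greatest:
  assumes "p \<in> paths H G"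
  obtains m where "m \<in> p" "\<And>r. r \<in> p \<Longrightarrow> pair_le r m"
proof -
  have "\<exists>m\<in>p. \<forall>r\<in>p. pair_le r m"
    by (rule finite_chain_greatest[OF path_finite[OF assms] path_nonempty[OF assms]
          path_chain[OF assms] pair_le_trans])
  then show ?thesis
    using that by blast
qed

text \<open>If a filter above \<open>fst r\<close> with \<open>r \<in> q\<close> is the first component of some \<open>s \<in> p\<close> that does not precede \<open>r\<close>,
  then \<open>r\<close> precedes \<open>s\<close>, both have the same first component, and \<open>r\<close> may replace \<open>s\<close>.\<close>

lemma initial_path:
  assumes p: "p \<in> paths H G" and q: "initial q p" "q \<noteq> {}"
  shows "q \<in> paths H G"
proof -
  have sub: "q \<subseteq> p" and down: "\<And>r s. r \<in> p \<Longrightarrow> s \<in> q \<Longrightarrow> pair_le r s \<Longrightarrow> r \<in> q"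
    using q(1) unfolding initial_def by blast+
  have "F \<in> fst ` q" if r: "r \<in> q" and F: "F \<in> irr_filters H" "fst r \<subseteq> F" for r F
  proof -
    obtain s where s: "s \<in> p" "F = fst s"
      using path_down1[OF p _ F] r sub by blast
    show ?thesis
    proof (cases "pair_le s r")
      case False
      then have "pair_le r s"
        using path_chain[OF p s(1)] r sub by blast
      then have "F = fst r"
        using s(2) F(2) by (auto simp: pair_le_def)
      then show ?thesis using r by blast
    qed (use down[OF s(1) r] s in blast)
  qed
  moreover have "F \<in> snd ` q" if r: "r \<in> q" and F: "F \<in> irr_filters G" "snd r \<subseteq> F" for r F
  proof -
    obtain s where s: "s \<in> p" "F = snd s"
      using path_down2[OF p _ F] r sub by blast
    show ?thesis
    proof (cases "pair_le s r")
      case False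
      then have "pair_le r s"
        using path_chain[OF p s(1)] r sub by blast
      then have "F = snd r"
        using s(2) F(2) by (auto simp: pair_le_def)
      then show ?thesis using r by blast
    qed (use down[OF s(1) r] s in blast)
  qed
  moreover have "finite q" "q \<subseteq> irr_filters H \<times> irr_filters G"
    using finite_subset[OF sub path_finite[OF p]] path_subset[OF p] sub by auto
  moreover have "pair_le r s \<or> pair_le s r" if "r \<in> q" "s \<in> q" for r s
    using path_chain[OF p] sub that by blast
  ultimately show ?thesis
    unfolding paths_def mem_Collect_eq using q(2) by (intro conjI ballI impI)
qed

lemma initial_forest:
  assumes z: "z \<in> paths H G" and "initial p z" "initial q z"
  shows "initial p q \<or> initial q p"
proof -
  have "p \<subseteq> q \<or> q \<subseteq> p"
    using path_chain[OF z] assms(2,3) unfolding initial_def by blast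
  then show ?thesis
    using assms(2,3) unfolding initial_def by blast
qed

lemma initial_below:
  assumes "p \<in> paths H G" "t \<in> p"
  shows "initial {r \<in> p. pair_le r t} p" "{r \<in> p. pair_le r t} \<in> paths H G"
proof -
  show i: "initial {r \<in> p. pair_le r t} p"
    unfolding initial_def by (auto intro: pair_le_trans)
  show "{r \<in> p. pair_le r t} \<in> paths H G"
    by (rule initial_path[OF assms(1) i]) (use assms(2) pair_le_refl in blast)
qed

lemma finite_paths:
  assumes "finite (carrier H)" "finite (carrier G)"
  shows "finite (paths H G)"
proof -
  have "irr_filters H \<subseteq> Pow (carrier H)" "irr_filters G \<subseteq> Pow (carrier G)"
    by (auto simp: irr_filters_def irreducible_filter_def implicative_filter_def)
  then have "finite (irr_filters H \<times> irr_filters G)"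
    using assms by (meson finite_Pow_iff finite_SigmaI finite_subset)
  then show ?thesis
    by (rule finite_subset[OF _ finite_Pow_iff[THEN iffD2], rotated]) (auto simp: paths_def)
qed

section \<open>Paths are the points of the tensor product\<close>

abbreviation prod_dual ::
  "('a, 'm) hilbert_scheme \<Rightarrow> ('b, 'n) hilbert_scheme \<Rightarrow> ('a set \<times> 'b set) pos" where
  "prod_dual H G \<equiv> prod_pos (dual_space H) (dual_space G)"

lemma prod_dual_simps [simp]:
  "carrier (prod_dual H G) = irr_filters H \<times> irr_filters G"
  "leq (prod_dual H G) = pair_le"
  by (auto simp: prod_pos_def dual_space_def pair_le_def fun_eq_iff)

lemma enumerates_chain:
  assumes "enumerates (prod_dual H G) fs p"
  shows "finite p" "p \<noteq> {}" "p \<subseteq> irr_filters H \<times> irr_filters G"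
    "\<And>r s. r \<in> p \<Longrightarrow> s \<in> p \<Longrightarrow> pair_le r s \<or> pair_le s r"
    "hd fs \<in> p" "last fs \<in> p"
    "\<And>r. r \<in> p \<Longrightarrow> pair_le (hd fs) r" "\<And>r. r \<in> p \<Longrightarrow> pair_le r (last fs)"
proof -
  have fs: "fs \<noteq> []" "set fs = p" "sorted_wrt (\<lambda>x y. pair_le x y \<and> x \<noteq> y) fs"
    and sub: "p \<subseteq> irr_filters H \<times> irr_filters G"
    using assms by (auto simp: enumerates_def)
  show "finite p" "p \<noteq> {}" "hd fs \<in> p" "last fs \<in> p"
    using fs by auto
  show "p \<subseteq> irr_filters H \<times> irr_filters G"
    by (rule sub)
  show "pair_le (hd fs) r" if "r \<in> p" for r
    using fs that by (cases fs) auto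
  show "pair_le r (last fs)" if "r \<in> p" for r
    using fs that by (cases fs rule: rev_cases) (auto simp: sorted_wrt_append)
  show "pair_le r s \<or> pair_le s r" if rs: "r \<in> p" "s \<in> p" for r s
  proof -
    obtain i j where ij: "i < length fs" "j < length fs" "r = fs ! i" "s = fs ! j"
      using rs fs(2) by (auto simp: in_set_conv_nth)
    then show ?thesis
      using fs(3) unfolding sorted_wrt_iff_nth_less by (cases i j rule: linorder_cases) auto
  qed
qed

lemma chain_enumerates:
  assumes "finite p" "p \<noteq> {}" "p \<subseteq> irr_filters H \<times> irr_filters G"
    "\<And>r s. r \<in> p \<Longrightarrow> s \<in> p \<Longrightarrow> pair_le r s \<or> pair_le s r"
  shows "\<exists>fs. enumerates (prod_dual H G) fs p"
  using assms
proof (induction p rule: finite_psubset_induct)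
  case (psubset p)
  have "\<exists>m\<in>p. \<forall>r\<in>p. pair_le r m"
    by (rule finite_chain_greatest[OF psubset.hyps psubset.prems(1,3) pair_le_trans])
  then obtain m where m: "m \<in> p" "\<And>r. r \<in> p \<Longrightarrow> pair_le r m"
    by blast
  show ?case
  proof (cases "p = {m}")
    case True
    then have "enumerates (prod_dual H G) [m] p"
      using psubset.prems(2) by (auto simp: enumerates_def)
    then show ?thesis ..
  next
    case False
    then have "p - {m} \<noteq> {}" "p - {m} \<subset> p"
      using m(1) by auto
    then obtain fs where "enumerates (prod_dual H G) fs (p - {m})"
      using psubset.IH[of "p - {m}"] psubset.prems(2,3) by blast
    then have "enumerates (prod_dual H G) (fs @ [m]) p"
      using m psubset.prems(2) by (auto simp: enumerates_def sorted_wrt_append)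
    then show ?thesis ..
  qed
qed

lemma path_enumerates:
  assumes "p \<in> paths H G"
  obtains fs where "enumerates (prod_dual H G) fs p"
  using chain_enumerates[OF path_finite[OF assms] path_nonempty[OF assms] path_subset[OF assms]
      path_chain[OF assms]] that by blast

lemma tensor_carrier_eq: "tensor_carrier (dual_space H) (dual_space G) = paths H G"
proof (intro equalityI subsetI)
  fix p assume "p \<in> tensor_carrier (dual_space H) (dual_space G)"
  then obtain ps where ps: "enumerates (prod_dual H G) ps p"
    and eq: "fst ` p = downset (dual_space H) (fst (last ps))"
      "snd ` p = downset (dual_space G) (snd (last ps))"
    unfolding tensor_carrier_def by blast
  note E = enumerates_chain[OF ps]
  have "F \<in> fst ` p" if "r \<in> p" "F \<in> irr_filters H" "fst r \<subseteq> F" for r F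
    using that E(8)[OF that(1)] unfolding eq by (auto simp: downset_def dual_space_def pair_le_def)
  moreover have "F \<in> snd ` p" if "r \<in> p" "F \<in> irr_filters G" "snd r \<subseteq> F" for r F
    using that E(8)[OF that(1)] unfolding eq by (auto simp: downset_def dual_space_def pair_le_def)
  ultimately show "p \<in> paths H G"
    unfolding paths_def mem_Collect_eq using E(1-4) by (intro conjI ballI impI)
next
  fix p assume p: "p \<in> paths H G"
  obtain ps where ps: "enumerates (prod_dual H G) ps p"
    using path_enumerates[OF p] by blast
  note E = enumerates_chain[OF ps]
  have "y = hd ps" if y: "y \<in> irr_filters H \<times> irr_filters G" "pair_le y (hd ps)" for y
  proof -
    obtain r s where rs: "r \<in> p" "fst y = fst r" "s \<in> p" "snd y = snd s"
      using path_down1[OF p E(5), of "fst y"] path_down2[OF p E(5), of "snd y"] y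
      unfolding pair_le_def by auto
    then show ?thesis
      using E(7)[OF rs(1)] E(7)[OF rs(3)] y(2) unfolding pair_le_def by (auto simp: prod_eq_iff)
  qed
  then have "hd ps \<in> minimals (prod_dual H G) (carrier (prod_dual H G))"
    using E(3,5) unfolding minimals_def by auto
  then have "p \<in> US (prod_dual H G)"
    using ps unfolding US_def by blast
  moreover have "fst ` p = downset (dual_space H) (fst (last ps))"
    using E(3,8) path_down1[OF p E(6)]
    by (fastforce simp: downset_def dual_space_def pair_le_def)
  moreover have "snd ` p = downset (dual_space G) (snd (last ps))"
    using E(3,8) path_down2[OF p E(6)]
    by (fastforce simp: downset_def dual_space_def pair_le_def)
  ultimately show "p \<in> tensor_carrier (dual_space H) (dual_space G)"
    using ps unfolding tensor_carrier_def by blast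
qed

text \<open>An initial segment of a chain is a prefix of the list that enumerates the chain.\<close>

lemma set_takeWhile_initial:
  assumes "sorted_wrt R xs" "\<And>r s. r \<in> set xs \<Longrightarrow> s \<in> p \<Longrightarrow> R r s \<Longrightarrow> r \<in> p"
  shows "set (takeWhile (\<lambda>x. x \<in> p) xs) = p \<inter> set xs"
  using assms by (induction xs) auto

lemma US_le_iff_initial:
  assumes p: "p \<in> paths H G" and q: "q \<in> paths H G"
  shows "US_le (prod_dual H G) p q \<longleftrightarrow> initial p q"
proof
  assume "US_le (prod_dual H G) p q"
  then obtain fs gs where fs: "enumerates (prod_dual H G) fs p"
    and gs: "enumerates (prod_dual H G) gs q"
    and pre: "length fs \<le> length gs" "\<forall>i<length fs. fs ! i = gs ! i"
    unfolding US_le_def by blast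
  have sets: "set fs = p" "set gs = q"
    using fs gs by (auto simp: enumerates_def)
  have sorted: "sorted_wrt (\<lambda>x y. pair_le x y \<and> x \<noteq> y) gs"
    using gs by (simp add: enumerates_def)
  have "p \<subseteq> q"
    using pre unfolding sets[symmetric] by (auto simp: in_set_conv_nth) (metis order_less_le_trans)
  moreover have "r \<in> p" if rs: "r \<in> q" "s \<in> p" "pair_le r s" for r s
  proof -
    obtain i j where ij: "i < length fs" "j < length gs" "s = gs ! i" "r = gs ! j"
      using rs pre unfolding sets[symmetric] by (auto simp: in_set_conv_nth)
    have "\<not> i < j"
      using sorted ij rs(3) pair_le_antisym unfolding sorted_wrt_iff_nth_less by blast
    then have "j < length fs" "r = fs ! j"
      using ij pre by auto
    then show ?thesis
      unfolding sets[symmetric] by simp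
  qed
  ultimately show "initial p q"
    unfolding initial_def by blast
next
  assume i: "initial p q"
  obtain gs where gs: "enumerates (prod_dual H G) gs q"
    using path_enumerates[OF q] by blast
  then have G: "set gs = q" "sorted_wrt (\<lambda>x y. pair_le x y \<and> x \<noteq> y) gs"
    by (auto simp: enumerates_def)
  define fs where "fs = takeWhile (\<lambda>x. x \<in> p) gs"
  have "set fs = p \<inter> set gs"
    unfolding fs_def by (rule set_takeWhile_initial[OF G(2)]) (use i G(1) in \<open>auto simp: initial_def\<close>)
  then have set: "set fs = p"
    using i G(1) by (auto simp: initial_def)
  have "sorted_wrt (\<lambda>x y. pair_le x y \<and> x \<noteq> y) fs"
    unfolding fs_def by (subst takeWhile_eq_take) (rule sorted_wrt_take[OF G(2)])
  then have "enumerates (prod_dual H G) fs p"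
    using set path_nonempty[OF p] path_subset[OF p] by (auto simp: enumerates_def)
  moreover have "length fs \<le> length gs" "\<forall>i<length fs. fs ! i = gs ! i"
    unfolding fs_def by (simp_all add: length_takeWhile_le takeWhile_nth)
  ultimately show "US_le (prod_dual H G) p q"
    using gs unfolding US_le_def by blast
qed

text \<open>The preimage of the set \<open>phi H a\<close> under the first projection of the tensor product.  The projection
  of a path is the smallest first component of its pairs, so that it contains \<open>a\<close> iff they all do.
  The corresponding cylinders over \<open>G\<close> are given by \<open>cyl2\<close>.\<close>

definition cyl1 :: "('a, 'm) hilbert_scheme \<Rightarrow> ('b, 'n) hilbert_scheme \<Rightarrow> 'a \<Rightarrow>
    ('a set \<times> 'b set) set set" where
  "cyl1 H G a = {p \<in> paths H G. \<forall>r\<in>p. a \<in> fst r}"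

definition cyl2 :: "('a, 'm) hilbert_scheme \<Rightarrow> ('b, 'n) hilbert_scheme \<Rightarrow> 'b \<Rightarrow>
    ('a set \<times> 'b set) set set" where
  "cyl2 H G b = {p \<in> paths H G. \<forall>r\<in>p. b \<in> snd r}"

lemma tproj_cyl1:
  "{p \<in> paths H G. tproj1 (dual_space H) p \<in> irr_filters H - phi H a} = paths H G - cyl1 H G a"
proof -
  have "tproj1 (dual_space H) p \<in> irr_filters H - phi H a \<longleftrightarrow> p \<notin> cyl1 H G a"
    if p: "p \<in> paths H G" for p
  proof -
    obtain m where m: "m \<in> p" "\<And>r. r \<in> p \<Longrightarrow> pair_le r m"
      using path_greatest[OF p] by blast
    have "tproj1 (dual_space H) p = fst m"
      unfolding tproj1_def greatest_of_def
      by (rule the_equality) (use m in \<open>auto simp: dual_space_def pair_le_def\<close>)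
    moreover have "fst m \<in> irr_filters H"
      using m(1) path_subset[OF p] by auto
    moreover have "p \<in> cyl1 H G a \<longleftrightarrow> a \<in> fst m"
      using m p unfolding cyl1_def pair_le_def by blast
    ultimately show ?thesis
      by (simp add: phi_def)
  qed
  then show ?thesis by blast
qed

lemma tproj_cyl2:
  "{p \<in> paths H G. tproj2 (dual_space G) p \<in> irr_filters G - phi G b} = paths H G - cyl2 H G b"
proof -
  have "tproj2 (dual_space G) p \<in> irr_filters G - phi G b \<longleftrightarrow> p \<notin> cyl2 H G b"
    if p: "p \<in> paths H G" for p
  proof -
    obtain m where m: "m \<in> p" "\<And>r. r \<in> p \<Longrightarrow> pair_le r m"
      using path_greatest[OF p] by blast
    have "tproj2 (dual_space G) p = snd m"
      unfolding tproj2_def greatest_of_def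
      by (rule the_equality) (use m in \<open>auto simp: dual_space_def pair_le_def\<close>)
    moreover have "snd m \<in> irr_filters G"
      using m(1) path_subset[OF p] by auto
    moreover have "p \<in> cyl2 H G b \<longleftrightarrow> b \<in> snd m"
      using m p unfolding cyl2_def pair_le_def by blast
    ultimately show ?thesis
      by (simp add: phi_def)
  qed
  then show ?thesis by blast
qed

section \<open>The algebra of paths\<close>

text \<open>The complement of the upset generated by \<open>T\<close>.  Every element of the algebra has this form, for one
  of the sets \<open>T\<close> singled out by \<open>basic\<close> below.\<close>

definition avoiding :: "('a, 'm) hilbert_scheme \<Rightarrow> ('b, 'n) hilbert_scheme \<Rightarrow>
    ('a set \<times> 'b set) set set \<Rightarrow> ('a set \<times> 'b set) set set" where
  "avoiding H G T = {q \<in> paths H G. \<forall>p\<in>T. \<not> initial p q}"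

definition mins :: "('a set \<times> 'b set) set set \<Rightarrow> ('a set \<times> 'b set) set set" where
  "mins A = {x \<in> A. \<forall>y\<in>A. initial y x \<longrightarrow> y = x}"

definition basic :: "('a, 'm) hilbert_scheme \<Rightarrow> ('b, 'n) hilbert_scheme \<Rightarrow>
    ('a set \<times> 'b set) set set \<Rightarrow> bool" where
  "basic H G T \<longleftrightarrow> (\<exists>u\<in>paths H G. T = {u}) \<or>
     (\<exists>a\<in>carrier H. T \<subseteq> mins (paths H G - cyl1 H G a)) \<or>
     (\<exists>b\<in>carrier G. T \<subseteq> mins (paths H G - cyl2 H G b))"

lemma mins_subset: "mins A \<subseteq> A"
  by (auto simp: mins_def)

lemma mins_antichain: "x \<in> mins A \<Longrightarrow> y \<in> mins A \<Longrightarrow> initial x y \<Longrightarrow> x = y"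
  by (auto simp: mins_def)

lemma basic_subset_paths: "basic H G T \<Longrightarrow> T \<subseteq> paths H G"
  unfolding basic_def using mins_subset by blast

lemma tensor_pos_simps:
  "carrier (tensor_pos (dual_space H) (dual_space G)) = paths H G"
  "leq (tensor_pos (dual_space H) (dual_space G)) = US_le (prod_dual H G)"
  by (simp_all add: tensor_pos_def tensor_carrier_eq)

lemma upset_tensor:
  assumes "T \<subseteq> paths H G"
  shows "upset (tensor_pos (dual_space H) (dual_space G)) T = paths H G - avoiding H G T"
  using assms US_le_iff_initial[of _ H G]
  unfolding upset_def tensor_pos_simps avoiding_def by blast

lemma minimals_tensor:
  assumes "T \<subseteq> paths H G"
  shows "minimals (tensor_pos (dual_space H) (dual_space G)) T = mins T"
  using assms US_le_iff_initial[of _ H G]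
  unfolding minimals_def tensor_pos_simps mins_def by blast

lemma tensor_fam_iff:
  "D \<in> tensor_fam (dual_space H) (dual_space G) \<longleftrightarrow>
    (\<exists>T. basic H G T \<and> D = paths H G - avoiding H G T)"
proof -
  let ?X = "dual_space H" and ?Y = "dual_space G" and ?Z = "tensor_pos (dual_space H) (dual_space G)"
  have fam: "fam ?X = kappa H" "fam ?Y = kappa G"
    by (simp_all add: dual_space_def)
  have min1: "minimals ?Z {p \<in> paths H G. tproj1 ?X p \<in> irr_filters H - phi H a} =
      mins (paths H G - cyl1 H G a)" for a
    by (simp only: tproj_cyl1 minimals_tensor[OF Diff_subset])
  have min2: "minimals ?Z {p \<in> paths H G. tproj2 ?Y p \<in> irr_filters G - phi G b} =
      mins (paths H G - cyl2 H G b)" for b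
    by (simp only: tproj_cyl2 minimals_tensor[OF Diff_subset])
  have fam1: "(\<exists>T V. D = upset ?Z T \<and> V \<in> kappa H \<and>
      T \<subseteq> minimals ?Z {p \<in> paths H G. tproj1 ?X p \<in> V}) \<longleftrightarrow>
      (\<exists>T. (\<exists>a\<in>carrier H. T \<subseteq> mins (paths H G - cyl1 H G a)) \<and> D = upset ?Z T)"
    unfolding min1[symmetric] kappa_def by blast
  have fam2: "(\<exists>T V. D = upset ?Z T \<and> V \<in> kappa G \<and>
      T \<subseteq> minimals ?Z {p \<in> paths H G. tproj2 ?Y p \<in> V}) \<longleftrightarrow>
      (\<exists>T. (\<exists>b\<in>carrier G. T \<subseteq> mins (paths H G - cyl2 H G b)) \<and> D = upset ?Z T)"
    unfolding min2[symmetric] kappa_def by blast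
  have "D \<in> tensor_fam ?X ?Y \<longleftrightarrow> (\<exists>T. basic H G T \<and> D = upset ?Z T)"
    unfolding tensor_fam_def tensor_carrier_eq fam Un_iff mem_Collect_eq fam1 fam2 basic_def
    by blast
  then show ?thesis
    using upset_tensor[OF basic_subset_paths] by metis
qed

lemma
  shows fin_coproduct_carrier:
      "U \<in> carrier (fin_coproduct H G) \<longleftrightarrow> (\<exists>T. basic H G T \<and> U = avoiding H G T)"
    and fin_coproduct_tt: "tt (fin_coproduct H G) = paths H G"
    and fin_coproduct_ff: "ff (fin_coproduct H G) = {}"
    and fin_coproduct_imp: "U \<subseteq> paths H G \<Longrightarrow>
      imp (fin_coproduct H G) U V = {z \<in> paths H G. \<forall>y\<in>paths H G. initial y z \<longrightarrow> y \<in> U \<longrightarrow> y \<in> V}"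
proof -
  have up: "upset (tensor (dual_space H) (dual_space G)) T =
      upset (tensor_pos (dual_space H) (dual_space G)) T" for T
    by (simp add: upset_def tensor_def tensor_pos_def)
  have "avoiding H G T \<subseteq> paths H G" for T
    by (auto simp: avoiding_def)
  then have "U \<subseteq> paths H G \<and> paths H G - U = paths H G - avoiding H G T \<longleftrightarrow> U = avoiding H G T" for T
    by blast
  then show "U \<in> carrier (fin_coproduct H G) \<longleftrightarrow> (\<exists>T. basic H G T \<and> U = avoiding H G T)"
    by (simp add: fin_coproduct_def dual_algebra_def tensor_def tensor_carrier_eq tensor_fam_iff) blast
  show "tt (fin_coproduct H G) = paths H G" "ff (fin_coproduct H G) = {}"
    by (simp_all add: fin_coproduct_def dual_algebra_def tensor_def tensor_carrier_eq)
  assume U: "U \<subseteq> paths H G"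
  then have "U - V \<subseteq> paths H G"
    by blast
  from upset_tensor[OF this]
  have "imp (fin_coproduct H G) U V = paths H G - (paths H G - avoiding H G (U - V))"
    by (simp add: fin_coproduct_def dual_algebra_def up)
      (simp add: tensor_def tensor_carrier_eq)
  then show "imp (fin_coproduct H G) U V =
      {z \<in> paths H G. \<forall>y\<in>paths H G. initial y z \<longrightarrow> y \<in> U \<longrightarrow> y \<in> V}"
    using U by (auto simp: avoiding_def)
qed

locale finite_pair =
  fixes H :: "'a bhilbert" and G :: "'b bhilbert"
  assumes H: "bounded_prelinear_hilbert H" and finite_H: "finite (carrier H)"
    and G: "bounded_prelinear_hilbert G" and finite_G: "finite (carrier G)"
begin

abbreviation "Z \<equiv> paths H G"
abbreviation "C \<equiv> fin_coproduct H G"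

lemma irr_iff:
  "P \<in> irr_filters H \<longleftrightarrow> linear_filter H P" "Q \<in> irr_filters G \<longleftrightarrow> linear_filter G Q"
  using irreducible_iff_linear[OF bounded_prelinear[OF H]]
    irreducible_iff_linear[OF bounded_prelinear[OF G]] by (simp_all add: irr_filters_def)

lemma path_linear:
  assumes "p \<in> Z" "r \<in> p"
  shows "linear_filter H (fst r)" "linear_filter G (snd r)"
  using path_subset[OF assms(1)] assms(2) unfolding irr_iff[symmetric] by auto

lemma cyl_ff: "cyl1 H G (ff H) = {}" "cyl2 H G (ff G) = {}"
proof -
  have "ff H \<notin> fst r" "ff G \<notin> snd r" if "p \<in> Z" "r \<in> p" for p r
    using path_linear[OF that] ff_notin_proper[OF H] ff_notin_proper[OF G] linear_filterD(1,2)
    by metis+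
  then show "cyl1 H G (ff H) = {}" "cyl2 H G (ff G) = {}"
    using path_nonempty unfolding cyl1_def cyl2_def by blast+
qed

lemma cyl_tt: "cyl1 H G (tt H) = Z" "cyl2 H G (tt G) = Z"
  using path_linear[THEN linear_filterD(1)] filter_tt unfolding cyl1_def cyl2_def by blast+

definition down :: "('a set \<times> 'b set) set set \<Rightarrow> bool" where
  "down U \<longleftrightarrow> U \<subseteq> Z \<and> (\<forall>x\<in>U. \<forall>y\<in>Z. initial y x \<longrightarrow> y \<in> U)"

lemma downD: "down U \<Longrightarrow> U \<subseteq> Z" "down U \<Longrightarrow> x \<in> U \<Longrightarrow> y \<in> Z \<Longrightarrow> initial y x \<Longrightarrow> y \<in> U"
  unfolding down_def by blast+

lemma down_cyl: "down (cyl1 H G a)" "down (cyl2 H G b)"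
  unfolding down_def cyl1_def cyl2_def initial_def by blast+

lemma down_avoiding: "down (avoiding H G T)"
  unfolding down_def avoiding_def using initial_trans by blast

text \<open>Paths are finite, so that each path outside \<open>U\<close> lies above a minimal one.\<close>

lemma avoiding_mins:
  assumes U: "down U"
  shows "avoiding H G (mins (Z - U)) = U"
proof (intro equalityI subsetI)
  fix z assume z: "z \<in> avoiding H G (mins (Z - U))"
  show "z \<in> U"
  proof (rule ccontr)
    assume "z \<notin> U"
    then have "z \<in> Z - U \<and> initial z z"
      using z by (simp add: avoiding_def)
    from ex_has_least_nat[where P = "\<lambda>x. x \<in> Z - U \<and> initial x z" and m = card, OF this]
    obtain x where x: "x \<in> Z - U" "initial x z"
      and least: "\<forall>y. y \<in> Z - U \<and> initial y z \<longrightarrow> card x \<le> card y"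
      by (elim exE conjE)
    have "y = x" if y: "y \<in> Z - U" "initial y x" for y
    proof (rule card_seteq)
      show "finite x"
        using x(1) path_finite by blast
      show "y \<subseteq> x"
        using y(2) by (simp add: initial_def)
      show "card x \<le> card y"
        using least y(1) initial_trans[OF y(2) x(2)] by simp
    qed
    then have "x \<in> mins (Z - U)"
      using x(1) unfolding mins_def by blast
    then show False
      using z x(2) unfolding avoiding_def by blast
  qed
next
  fix z assume "z \<in> U"
  then show "z \<in> avoiding H G (mins (Z - U))"
    using U unfolding avoiding_def mins_def down_def by blast
qed

lemma basic_subset:
  assumes "basic H G T" and sub: "T' \<subseteq> T"
  shows "basic H G T'"
proof -
  have e: "basic H G {}"
    using ff_closed[OF H] unfolding basic_def by blast
  consider u where "u \<in> Z" "T = {u}"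
    | a where "a \<in> carrier H" "T \<subseteq> mins (Z - cyl1 H G a)"
    | b where "b \<in> carrier G" "T \<subseteq> mins (Z - cyl2 H G b)"
    using assms(1) unfolding basic_def by blast
  then show ?thesis
  proof cases
    case 1
    then have "T' = {} \<or> T' = T"
      using sub by blast
    then show ?thesis
      using e assms(1) by blast
  next
    case 2
    then show ?thesis
      unfolding basic_def using subset_trans[OF sub] by blast
  next
    case 3
    then show ?thesis
      unfolding basic_def using subset_trans[OF sub] by blast
  qed
qed

lemma coproduct_down: "U \<in> carrier C \<Longrightarrow> down U"
  using down_avoiding unfolding fin_coproduct_carrier by blast

text \<open>Forming \<open>U \<Rightarrow> _\<close> discards from the generators \<open>T\<close> of an upset those outside \<open>U\<close>.  This one rule gives
  the closure of the algebra under implication, since the family of admissible \<open>T\<close> is closed under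
  subsets, and it is the tool for cutting \<open>T\<close> down in the proof of generation.\<close>

lemma imp_avoiding:
  assumes U: "down U" and T: "T \<subseteq> Z"
  shows "imp C U (avoiding H G T) = avoiding H G (T \<inter> U)"
proof -
  have "z \<in> imp C U (avoiding H G T) \<longleftrightarrow> z \<in> avoiding H G (T \<inter> U)" if z: "z \<in> Z" for z
    unfolding fin_coproduct_imp[OF downD(1)[OF U]] avoiding_def mem_Collect_eq
  proof (intro iffI conjI z ballI impI)
    fix p assume "z \<in> Z \<and> (\<forall>y\<in>Z. initial y z \<longrightarrow> y \<in> U \<longrightarrow> y \<in> Z \<and> (\<forall>p\<in>T. \<not> initial p y))"
      and "p \<in> T \<inter> U"
    then show "\<not> initial p z"
      using T initial_refl by blast
  next
    fix y p assume "z \<in> Z \<and> (\<forall>p\<in>T \<inter> U. \<not> initial p z)" "initial y z" "y \<in> U" "p \<in> T"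
    then show "\<not> initial p y"
      using T downD(2)[OF U] initial_trans by blast
  qed
  then show ?thesis
    using fin_coproduct_imp[OF downD(1)[OF U]] unfolding avoiding_def by blast
qed

lemma coproduct_closed:
  assumes "U \<in> carrier C" "V \<in> carrier C"
  shows "imp C U V \<in> carrier C"
proof -
  obtain T where T: "basic H G T" "V = avoiding H G T"
    using assms(2) unfolding fin_coproduct_carrier by blast
  show ?thesis
    unfolding fin_coproduct_carrier T(2)
      imp_avoiding[OF coproduct_down[OF assms(1)] basic_subset_paths[OF T(1)]]
    using basic_subset[OF T(1)] by blast
qed

lemma cyl_carrier:
  "a \<in> carrier H \<Longrightarrow> cyl1 H G a \<in> carrier C" "b \<in> carrier G \<Longrightarrow> cyl2 H G b \<in> carrier C"
  unfolding fin_coproduct_carrier basic_def using avoiding_mins[OF down_cyl(1)] avoiding_mins[OF down_cyl(2)]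
  by (metis subset_refl)+

lemma coproduct_bounded_prelinear: "bounded_prelinear_hilbert C"
proof -
  have ff: "{} \<in> carrier C" and tt: "Z \<in> carrier C"
    using cyl_carrier(1)[OF ff_closed[OF H]] cyl_carrier(1)[OF tt_closed[OF bounded_hilbert[OF H]]]
    by (simp_all add: cyl_ff cyl_tt)
  have "prelinear_hilbert C"
  proof (rule prelinear_downsets[where Z = Z and le = initial])
    show "initial x y \<or> initial y x" if "z \<in> Z" "initial x z" "initial y z" for x y z
      by (rule initial_forest[OF that])
    show "x \<in> U \<Longrightarrow> y \<in> Z \<Longrightarrow> initial y x \<Longrightarrow> y \<in> U" if "U \<in> carrier C" for U x y
      by (rule downD(2)[OF coproduct_down[OF that]])
    show "U \<subseteq> Z" if "U \<in> carrier C" for U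
      by (rule downD(1)[OF coproduct_down[OF that]])
    then show "imp C U V = {z \<in> Z. \<forall>y\<in>Z. initial y z \<longrightarrow> y \<in> U \<longrightarrow> y \<in> V}"
      if "U \<in> carrier C" for U V
      using that by (simp add: fin_coproduct_imp)
  qed (simp_all add: tt fin_coproduct_tt coproduct_closed, blast intro: initial_trans)
  moreover have "hil_le C {} U" for U
    unfolding hil_le_def fin_coproduct_tt by (simp add: fin_coproduct_imp)
  ultimately show ?thesis
    unfolding bounded_prelinear_hilbert_def fin_coproduct_ff using ff by blast
qed

text \<open>To test \<open>a \<rightarrow> b\<close> at a pair \<open>r\<close> of the path \<open>z\<close>, consider a linear filter \<open>Q\<close> above \<open>fst r\<close>.  It is the first
  component of some \<open>s \<in> z\<close>, and the initial segment of \<open>z\<close> that ends in \<open>s\<close> decides whether \<open>a \<in> Q\<close> forces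
  \<open>b \<in> Q\<close>.\<close>

lemma cyl1_imp:
  assumes c: "a \<in> carrier H" "b \<in> carrier H"
  shows "cyl1 H G (imp H a b) = imp C (cyl1 H G a) (cyl1 H G b)"
proof -
  have "z \<in> cyl1 H G (imp H a b) \<longleftrightarrow>
      (\<forall>y\<in>Z. initial y z \<longrightarrow> y \<in> cyl1 H G a \<longrightarrow> y \<in> cyl1 H G b)" if z: "z \<in> Z" for z
  proof
    assume i: "z \<in> cyl1 H G (imp H a b)"
    have "b \<in> fst r" if "y \<in> Z" "initial y z" "r \<in> y" "a \<in> fst r" for y r
    proof -
      have "imp H a b \<in> fst r"
        using i that unfolding cyl1_def initial_def by blast
      then show ?thesis
        using filter_mp[OF linear_filterD(1)[OF path_linear(1)[OF that(1,3)]] that(4) _ c(2)] by blast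
    qed
    then show "\<forall>y\<in>Z. initial y z \<longrightarrow> y \<in> cyl1 H G a \<longrightarrow> y \<in> cyl1 H G b"
      unfolding cyl1_def by blast
  next
    assume i: "\<forall>y\<in>Z. initial y z \<longrightarrow> y \<in> cyl1 H G a \<longrightarrow> y \<in> cyl1 H G b"
    have "imp H a b \<in> fst r" if r: "r \<in> z" for r
      unfolding imp_mem_linear[OF bounded_hilbert[OF H] path_linear(1)[OF z r] c]
    proof (intro allI impI)
      fix Q assume Q: "linear_filter H Q \<and> fst r \<subseteq> Q" "a \<in> Q"
      then obtain s where s: "s \<in> z" "Q = fst s"
        using path_down1[OF z r, of Q] irr_iff(1) by blast
      note y = initial_below[OF z s(1)]
      have "{t \<in> z. pair_le t s} \<in> cyl1 H G a"
        using y(2) Q(2) unfolding cyl1_def pair_le_def s(2) by blast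
      then have "{t \<in> z. pair_le t s} \<in> cyl1 H G b"
        using i y by blast
      then show "b \<in> Q"
        using s pair_le_refl unfolding cyl1_def by blast
    qed
    then show "z \<in> cyl1 H G (imp H a b)"
      using z unfolding cyl1_def by blast
  qed
  then show ?thesis
    unfolding fin_coproduct_imp[OF downD(1)[OF down_cyl(1)]] using downD(1)[OF down_cyl(1)] by blast
qed

lemma cyl2_imp:
  assumes c: "a \<in> carrier G" "b \<in> carrier G"
  shows "cyl2 H G (imp G a b) = imp C (cyl2 H G a) (cyl2 H G b)"
proof -
  have "z \<in> cyl2 H G (imp G a b) \<longleftrightarrow>
      (\<forall>y\<in>Z. initial y z \<longrightarrow> y \<in> cyl2 H G a \<longrightarrow> y \<in> cyl2 H G b)" if z: "z \<in> Z" for z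
  proof
    assume i: "z \<in> cyl2 H G (imp G a b)"
    have "b \<in> snd r" if "y \<in> Z" "initial y z" "r \<in> y" "a \<in> snd r" for y r
    proof -
      have "imp G a b \<in> snd r"
        using i that unfolding cyl2_def initial_def by blast
      then show ?thesis
        using filter_mp[OF linear_filterD(1)[OF path_linear(2)[OF that(1,3)]] that(4) _ c(2)] by blast
    qed
    then show "\<forall>y\<in>Z. initial y z \<longrightarrow> y \<in> cyl2 H G a \<longrightarrow> y \<in> cyl2 H G b"
      unfolding cyl2_def by blast
  next
    assume i: "\<forall>y\<in>Z. initial y z \<longrightarrow> y \<in> cyl2 H G a \<longrightarrow> y \<in> cyl2 H G b"
    have "imp G a b \<in> snd r" if r: "r \<in> z" for r
      unfolding imp_mem_linear[OF bounded_hilbert[OF G] path_linear(2)[OF z r] c]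
    proof (intro allI impI)
      fix Q assume Q: "linear_filter G Q \<and> snd r \<subseteq> Q" "a \<in> Q"
      then obtain s where s: "s \<in> z" "Q = snd s"
        using path_down2[OF z r, of Q] irr_iff(2) by blast
      note y = initial_below[OF z s(1)]
      have "{t \<in> z. pair_le t s} \<in> cyl2 H G a"
        using y(2) Q(2) unfolding cyl2_def pair_le_def s(2) by blast
      then have "{t \<in> z. pair_le t s} \<in> cyl2 H G b"
        using i y by blast
      then show "b \<in> Q"
        using s pair_le_refl unfolding cyl2_def by blast
    qed
    then show "z \<in> cyl2 H G (imp G a b)"
      using z unfolding cyl2_def by blast
  qed
  then show ?thesis
    unfolding fin_coproduct_imp[OF downD(1)[OF down_cyl(2)]] using downD(1)[OF down_cyl(2)] by blast
qed

lemma cyl_hom: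
  "restrict (cyl1 H G) (carrier H) \<in> bhil_hom H C" "restrict (cyl2 H G) (carrier G) \<in> bhil_hom G C"
  by (simp_all add: bhil_hom_def cyl_carrier cyl1_imp cyl2_imp cyl_ff cyl_tt fin_coproduct_tt
      fin_coproduct_ff imp_closed tt_closed ff_closed bounded_hilbert H G)

section \<open>Generation by the two factors\<close>

text \<open>Let \<open>S\<close> be a subalgebra that contains all cylinders.  By \<open>imp_avoiding\<close>, if \<open>avoiding H G T\<close> and \<open>U\<close>
  are in \<open>S\<close>, then so is \<open>avoiding H G (T \<inter> U)\<close>.  Hence an element \<open>u\<close> of a finite antichain \<open>T\<close> can be
  isolated, meaning that \<open>avoiding H G {u} \<in> S\<close>, once \<open>S\<close> separates \<open>u\<close> from the other elements of \<open>T\<close>;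
  and when all elements of \<open>T\<close> can be isolated, \<open>T\<close> can be replaced by any of its subsets.

  Every path \<open>u\<close> is isolated by induction on its length.  At the last step of \<open>u\<close> a coordinate drops to
  a smaller filter, so some cylinder \<open>e\<close> contains all proper initial segments of \<open>u\<close> but not \<open>u\<close>; take
  for \<open>T\<close> the minimal paths outside \<open>e\<close>.  If \<open>w\<close> is another element of \<open>T\<close>, then either some proper
  initial segment \<open>v\<close> of \<open>u\<close> is not one of \<open>w\<close>, and \<open>avoiding H G {v}\<close> separates the two by the induction
  hypothesis; or \<open>w\<close> continues \<open>u\<close> without its last pair \<open>m\<close> by a pair \<open>n \<noteq> m\<close>.  If \<open>n\<close> is not below
  \<open>m\<close>, a cylinder over an element of a component of \<open>m\<close> separates.  Otherwise \<open>u\<close> moves both coordinates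
  at once in its last step, whereas \<open>w\<close> moves only one of them first; the implication between two
  cylinders, one for each coordinate, detects this.\<close>

lemma coproduct_generated:
  assumes sub: "S \<subseteq> carrier C"
    and gen1: "\<And>a. a \<in> carrier H \<Longrightarrow> cyl1 H G a \<in> S"
    and gen2: "\<And>b. b \<in> carrier G \<Longrightarrow> cyl2 H G b \<in> S"
    and closed: "\<And>U V. U \<in> S \<Longrightarrow> V \<in> S \<Longrightarrow> imp C U V \<in> S"
  shows "S = carrier C"
proof -
  have dn: "down U" if "U \<in> S" for U
    using coproduct_down sub that by blast
  have cut: "avoiding H G (T \<inter> U) \<in> S" if "T \<subseteq> Z" "avoiding H G T \<in> S" "U \<in> S" for T U
    using closed[OF that(3,2)] imp_avoiding[OF dn[OF that(3)] that(1)] by simp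
  have minsZ: "mins (Z - e) \<subseteq> Z" for e
    using mins_subset by blast
  have fin: "finite (mins (Z - e))" for e
    using finite_subset[OF minsZ finite_paths[OF finite_H finite_G]] .
  have isolate: "avoiding H G {u} \<in> S"
    if e: "e \<in> S" and u: "u \<in> mins (Z - e)"
      and sep: "\<And>w. w \<in> mins (Z - e) \<Longrightarrow> w \<noteq> u \<Longrightarrow> \<exists>U\<in>S. (u \<in> U) \<noteq> (w \<in> U)" for e u
  proof -
    let ?T = "mins (Z - e)"
    have T: "avoiding H G ?T \<in> S"
      using avoiding_mins[OF dn[OF e]] e by simp
    \<comment> \<open>the roles of \<open>u\<close> and \<open>w\<close> can be exchanged, passing from \<open>U\<close> to \<open>U \<Rightarrow> avoiding H G ?T\<close>\<close>
    have one: "\<exists>U\<in>S. u \<in> U \<and> w \<notin> U" if w: "w \<in> ?T" "w \<noteq> u" for w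
    proof -
      obtain U where U: "U \<in> S" "(u \<in> U) \<noteq> (w \<in> U)"
        using sep[OF w] by blast
      show ?thesis
      proof (cases "u \<in> U")
        case False
        have "u \<in> avoiding H G (?T \<inter> U)"
          using False u minsZ mins_antichain[of _ "Z - e" u] unfolding avoiding_def by blast
        moreover have "w \<notin> avoiding H G (?T \<inter> U)"
          using False U(2) w(1) initial_refl unfolding avoiding_def by blast
        ultimately show ?thesis
          using cut[OF minsZ T U(1)] by blast
      qed (use U in blast)
    qed
    have "\<exists>T'. u \<in> T' \<and> T' \<subseteq> ?T - W \<and> avoiding H G T' \<in> S" if "finite W" "W \<subseteq> ?T - {u}" for W
      using that
    proof (induction W rule: finite_induct)
      case empty
      then show ?case
        using u T by blast
    next
      case (insert w W)
      then obtain T' where T': "u \<in> T'" "T' \<subseteq> ?T - W" "avoiding H G T' \<in> S"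
        by blast
      obtain U where U: "U \<in> S" "u \<in> U" "w \<notin> U"
        using one[of w] insert.prems by blast
      have "T' \<subseteq> Z"
        using T'(2) minsZ by blast
      then have "avoiding H G (T' \<inter> U) \<in> S"
        by (rule cut[OF _ T'(3) U(1)])
      moreover have "u \<in> T' \<inter> U"
        using T'(1) U(2) by blast
      moreover have "T' \<inter> U \<subseteq> ?T - insert w W"
        using T'(2) U(3) by blast
      ultimately show ?case
        by (intro exI[of _ "T' \<inter> U"] conjI)
    qed
    from this[of "?T - {u}"] obtain T' where "u \<in> T'" "T' \<subseteq> {u}" "avoiding H G T' \<in> S"
      using fin[of e] by (auto simp: subset_iff)
    then have "T' = {u}"
      by blast
    then show ?thesis
      using \<open>avoiding H G T' \<in> S\<close> by simp
  qed
  have single: "avoiding H G {u} \<in> S" if "u \<in> Z" for u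
    using that
  proof (induction "card u" arbitrary: u rule: less_induct)
    case less
    note u = less.prems
    have smaller: "avoiding H G {v} \<in> S" if v: "v \<in> Z" "initial v u" "v \<noteq> u" for v
    proof (rule less.hyps[OF _ v(1)])
      have "v \<subset> u"
        using v unfolding initial_def by blast
      then show "card v < card u"
        by (rule psubset_card_mono[OF path_finite[OF u]])
    qed
    obtain m where m: "m \<in> u" "\<And>r. r \<in> u \<Longrightarrow> pair_le r m"
      using path_greatest[OF u] by blast
    \<comment> \<open>the longest proper initial segment of \<open>u\<close>, or the empty set if \<open>u\<close> is a root\<close>
    define u' where "u' = u - {m}"
    have u': "u' \<subseteq> u" "m \<notin> u'" "u = insert m u'"
      using m(1) unfolding u'_def by blast+
    have init: "initial u' u"
      unfolding initial_def
    proof (intro conjI ballI impI u'(1))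
      fix r s assume rs: "r \<in> u" "s \<in> u'" "pair_le r s"
      have "r \<noteq> m"
        using rs(2,3) m(2)[of s] u'(1,2) pair_le_antisym[of m s] by auto
      then show "r \<in> u'"
        using rs(1) unfolding u'_def by blast
    qed
    have v_sub: "v \<subseteq> u'" if "initial v u" "v \<noteq> u" for v
    proof -
      have "m \<notin> v"
        using that m(2) unfolding initial_def by blast
      then show ?thesis
        using that(1) unfolding initial_def u'_def by blast
    qed
    have path': "u' \<in> Z" if "u' \<noteq> {}"
      by (rule initial_path[OF u init that])
    have u'_le: "\<exists>m'\<in>u'. (\<forall>r\<in>u'. pair_le r m')" if "u' \<noteq> {}"
      by (rule path_greatest[OF path'[OF that]]) blast
    have carH: "a \<in> carrier H" if "p \<in> Z" "r \<in> p" "a \<in> fst r" for p r a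
      using filter_subset[OF linear_filterD(1)[OF path_linear(1)[OF that(1,2)]]] that(3) by blast
    have carG: "b \<in> carrier G" if "p \<in> Z" "r \<in> p" "b \<in> snd r" for p r b
      using filter_subset[OF linear_filterD(1)[OF path_linear(2)[OF that(1,2)]]] that(3) by blast
    have "\<exists>e\<in>S. u \<notin> e \<and> (\<forall>v\<in>Z. initial v u \<and> v \<noteq> u \<longrightarrow> v \<in> e)"
    proof (cases "u' = {}")
      case True
      then have "\<not> (initial v u \<and> v \<noteq> u)" if "v \<in> Z" for v
        using v_sub[of v] path_nonempty[OF that] by blast
      moreover have "{} \<in> S"
        using gen1[OF ff_closed[OF H]] by (simp add: cyl_ff)
      ultimately show ?thesis
        by (intro bexI[of _ "{}"]) simp_all
    next
      case False
      then obtain m' where m': "m' \<in> u'" "\<And>r. r \<in> u' \<Longrightarrow> pair_le r m'"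
        using u'_le by blast
      have below: "pair_le r m'" if "initial v u" "v \<noteq> u" "r \<in> v" for v r
        using v_sub[OF that(1,2)] that(3) m'(2) by blast
      have "\<not> pair_le m m'"
        using m'(1) u'(1,2) m(2)[of m'] pair_le_antisym[of m m'] by auto
      then consider a where "a \<in> fst m'" "a \<notin> fst m" | b where "b \<in> snd m'" "b \<notin> snd m"
        unfolding pair_le_def by blast
      then show ?thesis
      proof cases
        case 1
        have "v \<in> cyl1 H G a" if "v \<in> Z" "initial v u" "v \<noteq> u" for v
          using below[OF that(2,3)] 1(1) that(1) unfolding cyl1_def pair_le_def by blast
        moreover have "u \<notin> cyl1 H G a"
          using m(1) 1(2) unfolding cyl1_def by blast
        moreover have "cyl1 H G a \<in> S"
          by (rule gen1[OF carH[OF u _ 1(1)]]) (use m'(1) u'(1) in blast)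
        ultimately show ?thesis
          by blast
      next
        case 2
        have "v \<in> cyl2 H G b" if "v \<in> Z" "initial v u" "v \<noteq> u" for v
          using below[OF that(2,3)] 2(1) that(1) unfolding cyl2_def pair_le_def by blast
        moreover have "u \<notin> cyl2 H G b"
          using m(1) 2(2) unfolding cyl2_def by blast
        moreover have "cyl2 H G b \<in> S"
          by (rule gen2[OF carG[OF u _ 2(1)]]) (use m'(1) u'(1) in blast)
        ultimately show ?thesis
          by blast
      qed
    qed
    then obtain e where e: "e \<in> S" "u \<notin> e" "\<And>v. v \<in> Z \<Longrightarrow> initial v u \<Longrightarrow> v \<noteq> u \<Longrightarrow> v \<in> e"
      by blast
    have uT: "u \<in> mins (Z - e)"
      using u e(2,3) unfolding mins_def by blast
    show ?case
    proof (rule isolate[OF e(1) uT])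
      fix w assume w: "w \<in> mins (Z - e)" "w \<noteq> u"
      have wZ: "w \<in> Z" "w \<notin> e"
        using w(1) unfolding mins_def by blast+
      have nuw: "\<not> initial u w"
        using mins_antichain[OF uT w(1)] w(2) by blast
      show "\<exists>U\<in>S. (u \<in> U) \<noteq> (w \<in> U)"
      proof (cases "\<exists>v\<in>Z. initial v u \<and> v \<noteq> u \<and> \<not> initial v w")
        case True
        then obtain v where v: "v \<in> Z" "initial v u" "v \<noteq> u" "\<not> initial v w"
          by blast
        then have "u \<notin> avoiding H G {v}" "w \<in> avoiding H G {v}"
          using wZ(1) by (auto simp: avoiding_def)
        then show ?thesis
          using smaller[OF v(1-3)] by blast
      next
        case False
        have u'w: "initial u' w"
          using False path' init u' by (cases "u' = {}") (auto simp: initial_def)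
        have "w \<noteq> u'"
          using e(3)[OF wZ(1)] wZ(2) init u' by blast
        then have ne: "w - u' \<noteq> {}"
          using u'w unfolding initial_def by blast
        have "\<exists>n\<in>w - u'. \<forall>r\<in>w - u'. pair_le n r"
          by (rule finite_chain_greatest[where R = "\<lambda>r s. pair_le s r"])
            (use ne path_finite[OF wZ(1)] path_chain[OF wZ(1)] pair_le_trans in blast)+
        then obtain n where n: "n \<in> w" "n \<notin> u'" "\<And>r. r \<in> w \<Longrightarrow> r \<notin> u' \<Longrightarrow> pair_le n r"
          by blast
        have n_not: "\<not> pair_le n s" if "s \<in> u'" for s
          using u'w n(1,2) that unfolding initial_def by blast
        have nm: "n \<noteq> m"
        proof
          assume [simp]: "n = m"
          have "initial u w"
            unfolding initial_def
          proof (intro conjI ballI impI)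
            show "u \<subseteq> w"
              using u'(3) u'w n(1) unfolding initial_def by auto
            fix r s assume rs: "r \<in> w" "s \<in> u" "pair_le r s"
            show "r \<in> u"
            proof (cases "r \<in> u'")
              case False
              then have "pair_le m r"
                using n(3)[OF rs(1)] by simp
              moreover have "pair_le r m"
                using pair_le_trans[OF rs(3) m(2)[OF rs(2)]] .
              ultimately show ?thesis
                using pair_le_antisym[of r m] m(1) by simp
            qed (use u'(1) in blast)
          qed
          then show False
            using nuw by simp
        qed
        let ?wn = "{t \<in> w. pair_le t n}"
        note wn = initial_below[OF wZ(1) n(1)]
        have n_in: "n \<in> ?wn"
          using n(1) by simp
        \<comment> \<open>\<open>?wn\<close> is a witness against \<open>U \<Rightarrow> V\<close> below \<open>w\<close>, and there is none below \<open>u\<close>\<close>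
        have corner: ?thesis
          if UV: "U \<in> S" "V \<in> S" and "u \<notin> U" "\<And>v. v \<in> Z \<Longrightarrow> initial v u \<Longrightarrow> v \<noteq> u \<Longrightarrow> v \<in> V"
            and wn': "?wn \<in> U" "?wn \<notin> V" for U V
        proof -
          have "u \<in> imp C U V"
            unfolding fin_coproduct_imp[OF downD(1)[OF dn[OF UV(1)]]] using u that(3,4) by blast
          moreover have "w \<notin> imp C U V"
            unfolding fin_coproduct_imp[OF downD(1)[OF dn[OF UV(1)]]] using wn wn' by blast
          ultimately show ?thesis
            using closed[OF UV] by blast
        qed
        consider a where "a \<in> fst m" "a \<notin> fst n" | b where "b \<in> snd m" "b \<notin> snd n" | "pair_le n m"
          unfolding pair_le_def by blast
        then show ?thesis
        proof cases
          case 1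
          have "u \<in> cyl1 H G a"
            using u m 1(1) unfolding cyl1_def pair_le_def by blast
          moreover have "w \<notin> cyl1 H G a"
            using n(1) 1(2) unfolding cyl1_def by blast
          ultimately show ?thesis
            using gen1[OF carH[OF u m(1) 1(1)]] by blast
        next
          case 2
          have "u \<in> cyl2 H G b"
            using u m 2(1) unfolding cyl2_def pair_le_def by blast
          moreover have "w \<notin> cyl2 H G b"
            using n(1) 2(2) unfolding cyl2_def by blast
          ultimately show ?thesis
            using gen2[OF carG[OF u m(1) 2(1)]] by blast
        next
          case 3
          then have nsub: "fst m \<subseteq> fst n" "snd m \<subseteq> snd n"
            by (simp_all add: pair_le_def)
          obtain r where r: "r \<in> u" "fst n = fst r"
            using path_down1[OF u m(1) _ nsub(1)] path_linear(1)[OF wZ(1) n(1)] irr_iff(1) by blast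
          obtain s where s: "s \<in> u" "snd n = snd s"
            using path_down2[OF u m(1) _ nsub(2)] path_linear(2)[OF wZ(1) n(1)] irr_iff(2) by blast
          \<comment> \<open>otherwise \<open>n\<close> would lie below the larger of \<open>r\<close> and \<open>s\<close>, hence in \<open>u'\<close>\<close>
          have "r = m \<or> s = m"
          proof (rule ccontr)
            assume "\<not> ?thesis"
            then have rs: "r \<in> u'" "s \<in> u'"
              using r(1) s(1) u'(3) by blast+
            have "pair_le n r \<or> pair_le n s"
              using path_chain[OF u r(1) s(1)] r(2) s(2) by (auto simp: pair_le_def)
            then show False
              using n_not rs by blast
          qed
          then consider "fst n = fst m" "s \<in> u'" "snd n \<noteq> snd m" | "snd n = snd m" "r \<in> u'" "fst n \<noteq> fst m"
            using r s nm u'(3) by (metis insertE prod_eq_iff)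
          then show ?thesis
          proof cases
            case 1
            then obtain m' where m': "m' \<in> u'" "\<And>r. r \<in> u' \<Longrightarrow> pair_le r m'"
              using u'_le by blast
            have "\<not> fst m' \<subseteq> fst m"
              using n_not[OF m'(1)] m'(2)[OF 1(2)] 1(1) s(2) by (auto simp: pair_le_def)
            then obtain a where a: "a \<in> fst m'" "a \<notin> fst m"
              by blast
            obtain b where b: "b \<in> snd n" "b \<notin> snd m"
              using nsub(2) 1(3) by blast
            show ?thesis
            proof (rule corner)
              show "cyl2 H G b \<in> S"
                by (rule gen2[OF carG[OF wZ(1) n(1) b(1)]])
              show "cyl1 H G a \<in> S"
                by (rule gen1[OF carH[OF u _ a(1)]]) (use m'(1) u'(1) in blast)
              show "u \<notin> cyl2 H G b"
                using m(1) b(2) unfolding cyl2_def by blast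
              show "v \<in> cyl1 H G a" if v: "v \<in> Z" "initial v u" "v \<noteq> u" for v
              proof -
                have "a \<in> fst t" if "t \<in> v" for t
                  using m'(2)[of t] v_sub[OF v(2,3)] that a(1) unfolding pair_le_def by blast
                then show ?thesis
                  using v(1) unfolding cyl1_def by blast
              qed
              show "?wn \<in> cyl2 H G b"
                using wn(2) b(1) by (auto simp: cyl2_def pair_le_def)
              show "?wn \<notin> cyl1 H G a"
                using n_in a(2) 1(1) unfolding cyl1_def by blast
            qed
          next
            case 2
            then obtain m' where m': "m' \<in> u'" "\<And>r. r \<in> u' \<Longrightarrow> pair_le r m'"
              using u'_le by blast
            have "\<not> snd m' \<subseteq> snd m"
              using n_not[OF m'(1)] m'(2)[OF 2(2)] 2(1) r(2) by (auto simp: pair_le_def)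
            then obtain b where b: "b \<in> snd m'" "b \<notin> snd m"
              by blast
            obtain a where a: "a \<in> fst n" "a \<notin> fst m"
              using nsub(1) 2(3) by blast
            show ?thesis
            proof (rule corner)
              show "cyl1 H G a \<in> S"
                by (rule gen1[OF carH[OF wZ(1) n(1) a(1)]])
              show "cyl2 H G b \<in> S"
                by (rule gen2[OF carG[OF u _ b(1)]]) (use m'(1) u'(1) in blast)
              show "u \<notin> cyl1 H G a"
                using m(1) a(2) unfolding cyl1_def by blast
              show "v \<in> cyl2 H G b" if v: "v \<in> Z" "initial v u" "v \<noteq> u" for v
              proof -
                have "b \<in> snd t" if "t \<in> v" for t
                  using m'(2)[of t] v_sub[OF v(2,3)] that b(1) unfolding pair_le_def by blast
                then show ?thesis
                  using v(1) unfolding cyl2_def by blast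
              qed
              show "?wn \<in> cyl1 H G a"
                using wn(2) a(1) by (auto simp: cyl1_def pair_le_def)
              show "?wn \<notin> cyl2 H G b"
                using n_in b(2) 2(1) unfolding cyl2_def by blast
            qed
          qed
        qed
      qed
    qed
  qed
  have part: "avoiding H G T' \<in> S" if e: "e \<in> S" and T': "T' \<subseteq> mins (Z - e)" for e T'
  proof -
    let ?T = "mins (Z - e)"
    have "avoiding H G (?T - W) \<in> S" if "finite W" "W \<subseteq> ?T" for W
      using that
    proof (induction W rule: finite_induct)
      case empty
      then show ?case
        using avoiding_mins[OF dn[OF e]] e by simp
    next
      case (insert w W)
      then have w: "w \<in> ?T" "w \<in> Z"
        using minsZ by blast+
      have "avoiding H G ((?T - W) \<inter> avoiding H G {w}) \<in> S"
        by (rule cut[OF _ _ single[OF w(2)]]) (use insert minsZ in blast)+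
      moreover have "(?T - W) \<inter> avoiding H G {w} = ?T - insert w W"
        using mins_antichain[OF w(1)] minsZ initial_refl unfolding avoiding_def by blast
      ultimately show ?case
        by simp
    qed
    from this[of "?T - T'"] show ?thesis
      using fin[of e] T' by (simp add: double_diff)
  qed
  have "U \<in> S" if U: "U \<in> carrier C" for U
  proof -
    obtain T where T: "basic H G T" "U = avoiding H G T"
      using U unfolding fin_coproduct_carrier by blast
    then consider u where "u \<in> Z" "T = {u}"
      | a where "a \<in> carrier H" "T \<subseteq> mins (Z - cyl1 H G a)"
      | b where "b \<in> carrier G" "T \<subseteq> mins (Z - cyl2 H G b)"
      unfolding basic_def by blast
    then show ?thesis
      using single part[OF gen1] part[OF gen2] T(2) by cases blast+
  qed
  then show ?thesis
    using sub by blast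
qed

end

section \<open>The universal property\<close>

locale cocone = finite_pair H G
  for H :: "'a bhilbert" and G :: "'b bhilbert" +
  fixes K :: "'c bhilbert" and f :: "'a \<Rightarrow> 'c" and g :: "'b \<Rightarrow> 'c"
  assumes K: "bounded_prelinear_hilbert K"
    and f: "f \<in> bhil_hom H K" and g: "g \<in> bhil_hom G K"
begin

definition point :: "'c set \<Rightarrow> 'a set \<times> 'b set" where
  "point Q = (pullback H f Q, pullback G g Q)"

text \<open>The map dual to the mediating homomorphism.\<close>

definition trace :: "'c set \<Rightarrow> ('a set \<times> 'b set) set" where
  "trace P = point ` {Q. linear_filter K Q \<and> P \<subseteq> Q}"

lemma point_mono: "P \<subseteq> Q \<Longrightarrow> pair_le (point Q) (point P)"
  by (auto simp: point_def pair_le_def pullback_def)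

lemma chain_above:
  assumes "linear_filter K P" "linear_filter K Q" "P \<subseteq> Q" "linear_filter K R" "P \<subseteq> R"
  shows "Q \<subseteq> R \<or> R \<subseteq> Q"
  using filters_above_linear_chain[OF assms(1) linear_filterD(1)[OF assms(2)] assms(3)
      linear_filterD(1)[OF assms(4)] assms(5)] .

lemma trace_path:
  assumes P: "linear_filter K P"
  shows "trace P \<in> Z"
proof -
  have sub: "trace P \<subseteq> irr_filters H \<times> irr_filters G"
    using linear_filter_pullback[OF H K f] linear_filter_pullback[OF G K g]
    unfolding trace_def point_def by (auto simp: irr_iff)
  moreover have "trace P \<subseteq> Pow (carrier H) \<times> Pow (carrier G)"
    unfolding trace_def point_def pullback_def by auto
  then have "finite (trace P)"
    by (rule finite_subset) (simp add: finite_H finite_G)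
  moreover have "trace P \<noteq> {}"
    using P unfolding trace_def by blast
  moreover have "pair_le r s \<or> pair_le s r" if rs: "r \<in> trace P" "s \<in> trace P" for r s
  proof -
    obtain Q R where "linear_filter K Q" "P \<subseteq> Q" "r = point Q"
      and "linear_filter K R" "P \<subseteq> R" "s = point R"
      using rs unfolding trace_def by blast
    then show ?thesis
      using chain_above[OF P, of Q R] point_mono[of Q R] point_mono[of R Q] by blast
  qed
  moreover have "F \<in> fst ` trace P" if r: "r \<in> trace P" and F: "F \<in> irr_filters H" "fst r \<subseteq> F" for r F
  proof -
    obtain Q where Q: "linear_filter K Q" "P \<subseteq> Q" "pullback H f Q \<subseteq> F"
      using r F(2) unfolding trace_def point_def by auto
    obtain R where "linear_filter K R" "Q \<subseteq> R" "pullback H f R = F"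
      using pullback_open[OF H K f Q(1) _ Q(3)] F(1) irr_iff(1) by blast
    then have "point R \<in> trace P" "fst (point R) = F"
      using Q(2) unfolding trace_def point_def by auto
    then show ?thesis
      by force
  qed
  moreover have "F \<in> snd ` trace P" if r: "r \<in> trace P" and F: "F \<in> irr_filters G" "snd r \<subseteq> F" for r F
  proof -
    obtain Q where Q: "linear_filter K Q" "P \<subseteq> Q" "pullback G g Q \<subseteq> F"
      using r F(2) unfolding trace_def point_def by auto
    obtain R where "linear_filter K R" "Q \<subseteq> R" "pullback G g R = F"
      using pullback_open[OF G K g Q(1) _ Q(3)] F(1) irr_iff(2) by blast
    then have "point R \<in> trace P" "snd (point R) = F"
      using Q(2) unfolding trace_def point_def by auto
    then show ?thesis
      by force
  qed
  ultimately show ?thesis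
    unfolding paths_def mem_Collect_eq by (intro conjI ballI impI)
qed

lemma trace_below:
  assumes P: "linear_filter K P" and Q: "linear_filter K Q" "P \<subseteq> Q"
  shows "trace Q = {r \<in> trace P. pair_le r (point Q)}"
proof (intro equalityI subsetI)
  fix r assume "r \<in> trace Q"
  then show "r \<in> {r \<in> trace P. pair_le r (point Q)}"
    using Q(2) point_mono unfolding trace_def by blast
next
  fix r assume r: "r \<in> {r \<in> trace P. pair_le r (point Q)}"
  then obtain R where R: "linear_filter K R" "P \<subseteq> R" "r = point R"
    unfolding trace_def by blast
  have "\<exists>R. linear_filter K R \<and> Q \<subseteq> R \<and> r = point R"
  proof (cases "Q \<subseteq> R")
    case False
    then have "pair_le (point Q) r"
      using chain_above[OF P R(1,2) Q] point_mono R(3) by blast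
    then have "r = point Q"
      using r pair_le_antisym[of r "point Q"] by blast
    then show ?thesis
      using Q(1) by blast
  qed (use R in blast)
  then show "r \<in> trace Q"
    unfolding trace_def by blast
qed

text \<open>Through this description of the initial segments of \<open>trace P\<close>, testing an implication of sets of
  paths at \<open>trace P\<close> becomes testing an implication of \<open>K\<close> at \<open>P\<close>.\<close>

lemma trace_initial:
  assumes P: "linear_filter K P"
  shows "y \<in> Z \<and> initial y (trace P) \<longleftrightarrow> (\<exists>Q. linear_filter K Q \<and> P \<subseteq> Q \<and> y = trace Q)"
proof
  assume y: "y \<in> Z \<and> initial y (trace P)"
  then obtain m where m: "m \<in> y" "\<And>r. r \<in> y \<Longrightarrow> pair_le r m"
    using path_greatest[of y H G] by blast
  then obtain Q where Q: "linear_filter K Q" "P \<subseteq> Q" "m = point Q"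
    using y unfolding initial_def trace_def by blast
  have "y = trace Q"
    unfolding trace_below[OF P Q(1,2)] using y m Q(3) unfolding initial_def by blast
  then show "\<exists>Q. linear_filter K Q \<and> P \<subseteq> Q \<and> y = trace Q"
    using Q by blast
next
  assume "\<exists>Q. linear_filter K Q \<and> P \<subseteq> Q \<and> y = trace Q"
  then obtain Q where Q: "linear_filter K Q" "P \<subseteq> Q" "y = trace Q"
    by blast
  then have "point Q \<in> trace P"
    unfolding trace_def by blast
  then show "y \<in> Z \<and> initial y (trace P)"
    using initial_below[OF trace_path[OF P]] trace_below[OF P Q(1,2)] Q(3) by simp
qed

definition represents :: "'c \<Rightarrow> ('a set \<times> 'b set) set set \<Rightarrow> bool" where
  "represents k U \<longleftrightarrow> k \<in> carrier K \<and> (\<forall>P. linear_filter K P \<longrightarrow> (k \<in> P \<longleftrightarrow> trace P \<in> U))"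

lemma represents_unique: "represents k U \<Longrightarrow> represents l U \<Longrightarrow> k = l"
  using linear_filter_eqI[OF bounded_prelinear[OF K], of k l] unfolding represents_def by blast

lemma represents_tt: "represents (tt K) Z"
  using trace_path filter_tt[OF linear_filterD(1)] tt_closed[OF bounded_hilbert[OF K]]
  unfolding represents_def by blast

lemma represents_ff: "represents (ff K) {}"
  using ff_notin_proper[OF K] linear_filterD(1,2) ff_closed[OF K]
  unfolding represents_def by blast

lemma represents_imp:
  assumes k: "represents k U" and l: "represents l V" and U: "U \<subseteq> Z"
  shows "represents (imp K k l) (imp C U V)"
proof -
  have c: "k \<in> carrier K" "l \<in> carrier K"
    using k l by (simp_all add: represents_def)
  have "imp K k l \<in> P \<longleftrightarrow> trace P \<in> imp C U V" if P: "linear_filter K P" for P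
  proof -
    have "imp K k l \<in> P \<longleftrightarrow> (\<forall>Q. linear_filter K Q \<and> P \<subseteq> Q \<longrightarrow> trace Q \<in> U \<longrightarrow> trace Q \<in> V)"
      using k l unfolding imp_mem_linear[OF bounded_hilbert[OF K] P c] represents_def by blast
    also have "\<dots> \<longleftrightarrow> (\<forall>y. y \<in> Z \<and> initial y (trace P) \<longrightarrow> y \<in> U \<longrightarrow> y \<in> V)"
      unfolding trace_initial[OF P] by blast
    also have "\<dots> \<longleftrightarrow> trace P \<in> imp C U V"
      unfolding fin_coproduct_imp[OF U] using trace_path[OF P] by blast
    finally show ?thesis .
  qed
  then show ?thesis
    unfolding represents_def using imp_closed[OF bounded_hilbert[OF K] c] by blast
qed

lemma represents_cyl1:
  assumes "a \<in> carrier H"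
  shows "represents (f a) (cyl1 H G a)"
proof -
  have "f a \<in> P \<longleftrightarrow> trace P \<in> cyl1 H G a" if P: "linear_filter K P" for P
  proof -
    have "trace P \<in> cyl1 H G a \<longleftrightarrow> (\<forall>Q. linear_filter K Q \<and> P \<subseteq> Q \<longrightarrow> f a \<in> Q)"
      unfolding cyl1_def using trace_path[OF P] assms
      by (auto simp: trace_def point_def pullback_def)
    then show ?thesis
      using P by blast
  qed
  then show ?thesis
    unfolding represents_def using bhil_homD(1)[OF f assms] by blast
qed

lemma represents_cyl2:
  assumes "b \<in> carrier G"
  shows "represents (g b) (cyl2 H G b)"
proof -
  have "g b \<in> P \<longleftrightarrow> trace P \<in> cyl2 H G b" if P: "linear_filter K P" for P
  proof -
    have "trace P \<in> cyl2 H G b \<longleftrightarrow> (\<forall>Q. linear_filter K Q \<and> P \<subseteq> Q \<longrightarrow> g b \<in> Q)"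
      unfolding cyl2_def using trace_path[OF P] assms
      by (auto simp: trace_def point_def pullback_def)
    then show ?thesis
      using P by blast
  qed
  then show ?thesis
    unfolding represents_def using bhil_homD(1)[OF g assms] by blast
qed

lemma coproduct_represented:
  assumes "U \<in> carrier C"
  shows "\<exists>k. represents k U"
proof -
  have "{U \<in> carrier C. \<exists>k. represents k U} = carrier C"
    by (rule coproduct_generated)
      (use cyl_carrier represents_cyl1 represents_cyl2 coproduct_closed represents_imp
        downD(1)[OF coproduct_down] in blast)+
  then show ?thesis
    using assms by blast
qed

lemma mediating_hom:
  "\<exists>!h. h \<in> bhil_hom C K \<and>
     (\<forall>a\<in>carrier H. h (cyl1 H G a) = f a) \<and> (\<forall>b\<in>carrier G. h (cyl2 H G b) = g b)"
proof (rule ex_ex1I)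
  define h where "h = (\<lambda>U\<in>carrier C. SOME k. represents k U)"
  have rep: "represents (h U) U" if "U \<in> carrier C" for U
    using someI_ex[OF coproduct_represented[OF that]] that by (simp add: h_def)
  have eq: "h U = k" if "U \<in> carrier C" "represents k U" for U k
    by (rule represents_unique[OF rep[OF that(1)] that(2)])
  have "h \<in> carrier C \<rightarrow>\<^sub>E carrier K"
    using rep unfolding represents_def by (auto simp: h_def)
  moreover have "h (imp C U V) = imp K (h U) (h V)" if c: "U \<in> carrier C" "V \<in> carrier C" for U V
    by (rule eq[OF coproduct_closed[OF c] represents_imp[OF rep rep]])
      (use c downD(1)[OF coproduct_down] in blast)+
  moreover have "h (tt C) = tt K" "h (ff C) = ff K"
    using eq tt_closed[OF bounded_hilbert[OF coproduct_bounded_prelinear]]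
      ff_closed[OF coproduct_bounded_prelinear] represents_tt represents_ff
    by (simp_all add: fin_coproduct_tt fin_coproduct_ff)
  ultimately have "h \<in> bhil_hom C K"
    unfolding bhil_hom_def by blast
  moreover have "\<forall>a\<in>carrier H. h (cyl1 H G a) = f a" "\<forall>b\<in>carrier G. h (cyl2 H G b) = g b"
    using eq cyl_carrier represents_cyl1 represents_cyl2 by blast+
  ultimately show "\<exists>h. h \<in> bhil_hom C K \<and>
     (\<forall>a\<in>carrier H. h (cyl1 H G a) = f a) \<and> (\<forall>b\<in>carrier G. h (cyl2 H G b) = g b)"
    by blast
next
  fix h k
  assume h: "h \<in> bhil_hom C K \<and>
     (\<forall>a\<in>carrier H. h (cyl1 H G a) = f a) \<and> (\<forall>b\<in>carrier G. h (cyl2 H G b) = g b)"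
    and k: "k \<in> bhil_hom C K \<and>
     (\<forall>a\<in>carrier H. k (cyl1 H G a) = f a) \<and> (\<forall>b\<in>carrier G. k (cyl2 H G b) = g b)"
  have "{U \<in> carrier C. h U = k U} = carrier C"
    by (rule coproduct_generated)
      (use h k cyl_carrier coproduct_closed in \<open>auto simp: bhil_homD(2)\<close>)
  then have "h U = k U" if "U \<in> carrier C" for U
    using that by blast
  moreover have "h \<in> carrier C \<rightarrow>\<^sub>E carrier K" "k \<in> carrier C \<rightarrow>\<^sub>E carrier K"
    using h k by (simp_all add: bhil_hom_def)
  ultimately show "h = k"
    by (rule PiE_ext[rotated 2])
qed

end

theorem mainTheorem8:
  fixes H :: "'a bhilbert" and G :: "'b bhilbert"
  assumes "bounded_prelinear_hilbert H" and "finite (carrier H)"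
    and "bounded_prelinear_hilbert G" and "finite (carrier G)"
  shows "\<exists>\<iota>\<^sub>1 \<iota>\<^sub>2. bhil_coproduct TYPE('c) H G (fin_coproduct H G) \<iota>\<^sub>1 \<iota>\<^sub>2"
proof -
  interpret finite_pair H G
    by (rule finite_pair.intro) (rule assms)+
  let ?i = "restrict (cyl1 H G) (carrier H)" and ?j = "restrict (cyl2 H G) (carrier G)"
  have "\<exists>!h. h \<in> bhil_hom C K \<and> (\<forall>a\<in>carrier H. h (?i a) = f a) \<and> (\<forall>b\<in>carrier G. h (?j b) = g b)"
    if "bounded_prelinear_hilbert K" "f \<in> bhil_hom H K" "g \<in> bhil_hom G K"
    for K :: "'c bhilbert" and f g
  proof -
    interpret cocone H G K f g
      by unfold_locales (rule that)+
    show ?thesis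
      using mediating_hom by simp
  qed
  then have "bhil_coproduct TYPE('c) H G C ?i ?j"
    unfolding bhil_coproduct_def using coproduct_bounded_prelinear cyl_hom by blast
  then show ?thesis
    by blast
qed

end
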